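(* Assume $\beta_q\in L_1(\mathbb R_+)$ for $q=1,2$ (together with the standing assumptions in the context), and let $c>0$. Let $u$ be the solution of $$u'(t)+\sum_{q=1}^2\int_0^t\beta_q(t-s)\mathbf B_qu(s)\,ds=f(t),\ t>0,\qquad u(0)=u_0,$$ and let $U^n$ be the solution of the Crank–Nicolson interpolation-quadrature scheme $$\delta_tU^n+\sum_{q=1}^2Q^{(q)}_{n-1/2}(\mathbf B_qU)=f^{n-\frac12},\quad n\ge1,\qquad U^0=u_0 .$$ Then, with a positive constant $\mathcal C$ independent of the time step $k$, $$\|U^n-u(t_n)\|_A\le\mathcal Ck\Bigg\{e^{-\frac c2}\int_0^k\|u_{tt}(\zeta)\|d\zeta+k\sum_{n=2}^\infty e^{-\frac c2n}\int_{t_{n-1}}^{t_n}\|u_{ttt}(\zeta)\|d\zeta+\sum_{q=1}^2\|\beta_q\|_{L_1(0,\infty)}\sum_{n=1}^\infty e^{-\frac c2n}\Big(\int_0^k\|\mathbf B_qu_t(\zeta)\|d\zeta+k\int_k^{t_n}\|\mathbf B_qu_{tt}(\zeta)\|d\zeta\Big)\Bigg\}.$$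
   Context: $H$ is a real Hilbert space (such as $L^2(\Omega)$) with norm $\|\cdot\|$; $f:[0,\infty)\to H$. Standing assumptions: each $\mathbf B_q$ is a positive self-adjoint linear operator on a dense subspace $\mathcal D(\mathbf B_q)\subset H$; each $\beta_q$ is real-valued and of positive type on $(0,\infty)$ (i.e. $\int_0^T\varphi(t)\int_0^t\beta_q(t-s)\varphi(s)\,ds\,dt\ge0$ for all $T>0$ and continuous real $\varphi$), with $\int_0^1\beta_q\,dt<\infty$ and $0\le\beta_q(\infty)<\beta_q(0^+)\le\infty$. All $U^n$ lie in $\mathcal D(\mathbf B_1)\cap\mathcal D(\mathbf B_2)$, and $u$ is regular enough for the quantities in the estimate to be defined. Notation: $k>0$ is the time step, $t_n=nk$, $f^n=f(t_n)$, $\delta_tv^n=(v^n-v^{n-1})/k$, $v^{n-\frac12}=\frac12(v^n+v^{n-1})$, and for a sequence $(v^n)_{n\ge0}$ in $H$, $\|v^n\|_A=\sqrt{\sum_{n=0}^\infty e^{-cn}\|v^n\|^2}$ (here applied to $v^n=U^n-u(t_n)$, for which $v^0=0$). Interpolation quadrature: with $h(t)=\max(1-|t|,0)$, $$\chi^{(q)}_{0,0}=0,\qquad \chi^{(q)}_{n,0}=\int_0^k\beta_q(t_n-\zeta)h(\zeta/k)\,d\zeta\ (n\ge1),\qquad w^{(q)}_n=\int_{-k}^{\min(k,t_n)}\beta_q(t_n-\zeta)h(\zeta/k)\,d\zeta\ (n\ge0),$$ $$Q^{(q)}_n(\varphi)=\chi^{(q)}_{n,0}\varphi^0+\sum_{l=1}^nw^{(q)}_{n-l}\varphi^l,\qquad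 Q^{(q)}_{n-\frac12}(\varphi)=\tfrac12\big(Q^{(q)}_n(\varphi)+Q^{(q)}_{n-1}(\varphi)\big)\ (n\ge1).$$
   Formalization: f is assumed continuous on [0,∞): the scheme uses f(0) while the equation holds only for t>0, so without right-continuity at 0 the claim fails (u=0, f nonzero only at t=0). "Regular enough" is read as u in C^3 for t>0 with B_q u_tt continuous there. *)

theory Defs
  imports "HOL-Analysis.Analysis"
begin

section \<open>Unbounded operators\<close>

text \<open>An unbounded operator is a total function together with its domain; its values outside
  the domain carry no meaning.\<close>

definition adjoint_graph :: "'a::real_inner set \<Rightarrow> ('a \<Rightarrow> 'a) \<Rightarrow> ('a \<times> 'a) set" where
  "adjoint_graph D B = {(y, z). \<forall>x\<in>D. inner (B x) y = inner x z}"

definition selfadjoint_on :: "'a::real_inner set \<Rightarrow> ('a \<Rightarrow> 'a) \<Rightarrow> bool" where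
  "selfadjoint_on D B \<longleftrightarrow> adjoint_graph D B = (\<lambda>x. (x, B x)) ` D"

definition positive_selfadjoint :: "'a::real_inner set \<Rightarrow> ('a \<Rightarrow> 'a) \<Rightarrow> bool" where
  "positive_selfadjoint D B \<longleftrightarrow>
     subspace D \<and> closure D = UNIV \<and>
     (\<forall>x\<in>D. \<forall>y\<in>D. B (x + y) = B x + B y) \<and>
     (\<forall>r. \<forall>x\<in>D. B (r *\<^sub>R x) = r *\<^sub>R B x) \<and>
     selfadjoint_on D B \<and>
     (\<forall>x\<in>D. 0 \<le> inner (B x) x)"

section \<open>Kernels\<close>

text \<open>A kernel lives on the open half-line. The closed integration intervals below only touch
  its irrelevant value at 0 in a single point.\<close>

definition positive_type :: "(real \<Rightarrow> real) \<Rightarrow> bool" where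
  "positive_type \<beta> \<longleftrightarrow>
     (\<forall>T>0. \<forall>\<phi>. continuous_on {0..T} \<phi> \<longrightarrow>
        0 \<le> integral {0..T} (\<lambda>t. \<phi> t * integral {0..t} (\<lambda>s. \<beta> (t - s) * \<phi> s)))"

text \<open>The limits are taken in the extended reals, so that \<open>\<beta>\<close> may blow up at 0.\<close>

definition admissible_kernel :: "(real \<Rightarrow> real) \<Rightarrow> bool" where
  "admissible_kernel \<beta> \<longleftrightarrow>
     positive_type \<beta> \<and>
     \<beta> absolutely_integrable_on {0<..1} \<and>
     (\<exists>\<beta>inf \<beta>0 :: ereal.
        ((\<lambda>t. ereal (\<beta> t)) \<longlongrightarrow> \<beta>inf) at_top \<and>
        ((\<lambda>t. ereal (\<beta> t)) \<longlongrightarrow> \<beta>0) (at_right 0) \<and>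
        0 \<le> \<beta>inf \<and> \<beta>inf < \<beta>0)"

section \<open>The continuous problem\<close>

text \<open>Vector-valued integrals are Henstock--Kurzweil integrals: the Bochner integral of the
  library would force \<open>H\<close> to be separable. For an integrable kernel and continuous
  \<open>s \<mapsto> B q (u s)\<close> the two integrals agree.\<close>

definition volterra_solution ::
  "(nat \<Rightarrow> real \<Rightarrow> real) \<Rightarrow> (nat \<Rightarrow> 'a::{real_inner,banach} set) \<Rightarrow> (nat \<Rightarrow> 'a \<Rightarrow> 'a) \<Rightarrow>
   (real \<Rightarrow> 'a) \<Rightarrow> 'a \<Rightarrow> (real \<Rightarrow> 'a) \<Rightarrow> bool" where
  "volterra_solution \<beta> D B f u0 u \<longleftrightarrow>
     continuous_on {0..} u \<and> u 0 = u0 \<and>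
     (\<forall>q\<in>{1..2}. \<forall>t\<ge>0. u t \<in> D q) \<and>
     (\<forall>t>0. u differentiable (at t) \<and>
        (\<forall>q\<in>{1..2}. (\<lambda>s. \<beta> q (t - s) *\<^sub>R B q (u s)) integrable_on {0..t}) \<and>
        vector_derivative u (at t)
          + (\<Sum>q=1..2. integral {0..t} (\<lambda>s. \<beta> q (t - s) *\<^sub>R B q (u s))) = f t)"

text \<open>Regularity away from \<open>t = 0\<close> only; the derivatives may be singular at 0. Since every
  \<open>B q\<close> is closed, \<open>B q (ut t)\<close> and \<open>B q (utt t)\<close> are the derivatives of \<open>B q (u t)\<close>.\<close>

definition regular_solution ::
  "(nat \<Rightarrow> 'a::{real_inner,banach} set) \<Rightarrow> (nat \<Rightarrow> 'a \<Rightarrow> 'a) \<Rightarrow>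
   (real \<Rightarrow> 'a) \<Rightarrow> (real \<Rightarrow> 'a) \<Rightarrow> (real \<Rightarrow> 'a) \<Rightarrow> (real \<Rightarrow> 'a) \<Rightarrow> bool" where
  "regular_solution D B u ut utt uttt \<longleftrightarrow>
     (\<forall>t>0. (u has_vector_derivative ut t) (at t) \<and>
            (ut has_vector_derivative utt t) (at t) \<and>
            (utt has_vector_derivative uttt t) (at t)) \<and>
     continuous_on {0<..} uttt \<and>
     (\<forall>q\<in>{1..2}. (\<forall>t>0. ut t \<in> D q \<and> utt t \<in> D q) \<and>
                 continuous_on {0<..} (\<lambda>t. B q (utt t)))"

section \<open>The Crank--Nicolson interpolation-quadrature scheme\<close>

definition hat :: "real \<Rightarrow> real" where
  "hat t = max (1 - \<bar>t\<bar>) 0"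

definition chi0 :: "real \<Rightarrow> (real \<Rightarrow> real) \<Rightarrow> nat \<Rightarrow> real" where
  "chi0 k \<beta> n =
     (if n = 0 then 0 else integral {0..k} (\<lambda>\<zeta>. \<beta> (real n * k - \<zeta>) * hat (\<zeta> / k)))"

definition weight :: "real \<Rightarrow> (real \<Rightarrow> real) \<Rightarrow> nat \<Rightarrow> real" where
  "weight k \<beta> n =
     integral {- k..min k (real n * k)} (\<lambda>\<zeta>. \<beta> (real n * k - \<zeta>) * hat (\<zeta> / k))"

definition quadr :: "real \<Rightarrow> (real \<Rightarrow> real) \<Rightarrow> (nat \<Rightarrow> 'a::real_vector) \<Rightarrow> nat \<Rightarrow> 'a" where
  "quadr k \<beta> \<phi> n = chi0 k \<beta> n *\<^sub>R \<phi> 0 + (\<Sum>l=1..n. weight k \<beta> (n - l) *\<^sub>R \<phi> l)"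

text \<open>\<open>mid v n\<close> is the value at index \<open>n - 1/2\<close>; like \<open>diffq k v n\<close> it is only used for
  \<open>n \<ge> 1\<close>.\<close>

definition mid :: "(nat \<Rightarrow> 'a::real_vector) \<Rightarrow> nat \<Rightarrow> 'a" where
  "mid v n = (1 / 2) *\<^sub>R (v n + v (n - 1))"

definition diffq :: "real \<Rightarrow> (nat \<Rightarrow> 'a::real_vector) \<Rightarrow> nat \<Rightarrow> 'a" where
  "diffq k v n = (1 / k) *\<^sub>R (v n - v (n - 1))"

definition cn_scheme ::
  "(nat \<Rightarrow> real \<Rightarrow> real) \<Rightarrow> (nat \<Rightarrow> 'a::{real_inner,banach} set) \<Rightarrow> (nat \<Rightarrow> 'a \<Rightarrow> 'a) \<Rightarrow>
   (real \<Rightarrow> 'a) \<Rightarrow> 'a \<Rightarrow> real \<Rightarrow> (nat \<Rightarrow> 'a) \<Rightarrow> bool" where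
  "cn_scheme \<beta> D B f u0 k U \<longleftrightarrow>
     U 0 = u0 \<and>
     (\<forall>q\<in>{1..2}. \<forall>n. U n \<in> D q) \<and>
     (\<forall>n\<ge>1. diffq k U n + (\<Sum>q=1..2. mid (quadr k (\<beta> q) (\<lambda>j. B q (U j))) n)
              = mid (\<lambda>j. f (real j * k)) n)"

section \<open>The weighted norm\<close>

text \<open>The value is infinite if the defining series diverges.\<close>

definition A_norm :: "real \<Rightarrow> (nat \<Rightarrow> 'a::real_normed_vector) \<Rightarrow> ennreal" where
  "A_norm c v =
     (if summable (\<lambda>n. exp (- c * real n) * (norm (v n))\<^sup>2)
      then ennreal (sqrt (\<Sum>n. exp (- c * real n) * (norm (v n))\<^sup>2))
      else \<infinity>)"

end

theory Submission
  imports Defs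
begin

text \<open>The error \<open>e n = U n - u (t n)\<close> solves the scheme with the truncation error \<open>\<tau>\<close> as right-hand
  side and \<open>e 0 = 0\<close>. The quadrature weights are the exact values of the positive quadratic form of
  \<open>\<beta>\<close> on step functions, so they form a positive definite sequence; since \<open>B\<close> is positive, the
  Schur product theorem makes the memory term nonnegative when the scheme is tested with the
  averages of \<open>e\<close>. Hence \<open>norm (e N) \<le> 2 * k * (\<Sum>n=1..N. norm (\<tau> n))\<close>, and multiplying by
  \<open>exp (- c * N / 2)\<close> and summing over \<open>N\<close> (a geometric series) bounds even the weighted
  \<open>\<ell>\<^sup>1\<close>-norm of \<open>e\<close>, which dominates the \<open>A\<close>-norm. The truncation error consists of a trapezoidal error
  of \<open>u'\<close> and of the piecewise linear interpolation error of \<open>B u\<close>; that \<open>B u\<close> is twice differentiable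
  follows by testing with the dense domain of \<open>B\<close>.\<close>

section \<open>Schur products\<close>

text \<open>The delicate point is time 0. Derivatives of u may blow up there and the differential
  equation is only assumed for t > 0, yet the scheme uses both f 0 and the operator values at u 0.
  The first cell is therefore treated with one derivative fewer than the others, which is where the
  separate integrals over (0,k) in the estimate come from. Finiteness of the integral of the norm of
  \<open>B q (ut \<zeta>)\<close> over that cell bounds \<open>B q (u s)\<close> near 0, so the
  memory term tends to 0 there and ut tends to f 0. If this integral is infinite, so is the
  right-hand side of the estimate. The second obstacle is the roughness of the kernel: it may be
  unbounded and discontinuous, and positive type speaks of continuous test functions only, whereas
  the weights correspond to step functions. The passage between them goes through the second
  primitive of the kernel, which is differentiable for every integrable kernel. All local errors are
  estimated by the variation of a derivative over a cell and the mean value inequality, which gives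
  constants such as 3/2 that are later rounded up to 2.\<close>

lemma sum_symmetric_insert:
  fixes A :: "'i \<Rightarrow> 'i \<Rightarrow> real"
  assumes "finite S" "p \<notin> S" "\<And>i j. A i j = A j i"
  shows "(\<Sum>i\<in>insert p S. \<Sum>j\<in>insert p S. A i j)
       = A p p + 2 * (\<Sum>j\<in>S. A p j) + (\<Sum>i\<in>S. \<Sum>j\<in>S. A i j)"
proof -
  have "(\<Sum>i\<in>S. A i p) = (\<Sum>j\<in>S. A p j)" by (intro sum.cong refl assms(3))
  then show ?thesis using assms(1,2) by (simp add: sum.distrib)
qed

text \<open>Symmetric Gaussian elimination, one index p at a time. A zero pivot forces the whole row
  p of W to vanish. A positive pivot lets W split into its Schur complement, which has zero row p
  and is handled by induction, and a rank one matrix, whose pairing with G is the quadratic form of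
  G at the row \<open>W p\<close>, divided by the pivot.\<close>

lemma sum_psd_products_nonneg:
  fixes W G :: "'i \<Rightarrow> 'i \<Rightarrow> real"
  assumes "finite S" "\<And>i j. W i j = W j i" "\<And>i j. G i j = G j i"
    and "\<And>x. 0 \<le> (\<Sum>i\<in>S. \<Sum>j\<in>S. W i j * x i * x j)"
    and "\<And>x. 0 \<le> (\<Sum>i\<in>S. \<Sum>j\<in>S. G i j * x i * x j)"
  shows "0 \<le> (\<Sum>i\<in>S. \<Sum>j\<in>S. W i j * G i j)"
  using assms
proof (induction S arbitrary: W rule: finite_induct)
  case empty
  then show ?case by simp
next
  case (insert p S)
  note fin = insert.hyps(1) and pS = insert.hyps(2)
  note symW = insert.prems(1) and symG = insert.prems(2)
  note W = insert.prems(3) and G = insert.prems(4)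
  have split: "(\<Sum>i\<in>insert p S. \<Sum>j\<in>insert p S. M i j * x i * x j)
     = M p p * x p * x p + 2 * (\<Sum>j\<in>S. M p j * x p * x j) + (\<Sum>i\<in>S. \<Sum>j\<in>S. M i j * x i * x j)"
    if "\<And>i j. M i j = M j i" for M :: "'i \<Rightarrow> 'i \<Rightarrow> real" and x
  proof (rule sum_symmetric_insert[OF fin pS])
    show "M i j * x i * x j = M j i * x j * x i" for i j using that[of i j] by simp
  qed
  have split0: "(\<Sum>i\<in>insert p S. \<Sum>j\<in>insert p S. M i j * G i j)
     = M p p * G p p + 2 * (\<Sum>j\<in>S. M p j * G p j) + (\<Sum>i\<in>S. \<Sum>j\<in>S. M i j * G i j)"
    if "\<And>i j. M i j = M j i" for M :: "'i \<Rightarrow> 'i \<Rightarrow> real"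
  proof (rule sum_symmetric_insert[OF fin pS])
    show "M i j * G i j = M j i * G j i" for i j using that[of i j] symG[of i j] by simp
  qed
  have GS: "0 \<le> (\<Sum>i\<in>S. \<Sum>j\<in>S. G i j * x i * x j)" for x
  proof -
    define y where "y = x(p := 0)"
    have "(\<Sum>i\<in>S. \<Sum>j\<in>S. G i j * y i * y j) = (\<Sum>i\<in>S. \<Sum>j\<in>S. G i j * x i * x j)"
      using pS by (intro sum.cong) (auto simp: y_def)
    with G[of y] split[of G y, OF symG] show ?thesis by (simp add: y_def)
  qed
  have Wpp: "0 \<le> W p p"
  proof -
    define x where "x = (\<lambda>i. if i = p then 1 else (0::real))"
    have "x p = 1" "\<And>i. i \<in> S \<Longrightarrow> x i = 0" using pS by (auto simp: x_def)
    then show ?thesis using W[of x] split[of W x, OF symW] by simp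
  qed
  show ?case
  proof (cases "W p p = 0")
    case True
    have 0: "W p j = 0" if j: "j \<in> S" for j
    proof (rule ccontr)
      assume nz: "W p j \<noteq> 0"
      \<comment> \<open>With \<open>W p p = 0\<close> the form at the vector with entries t at p and
        1 at j is \<open>2 * t * W p j + W j j\<close>, affine in t. This t makes it -1.\<close>
      define t where "t = - (W j j + 1) / (2 * W p j)"
      define x where "x = (\<lambda>i. if i = p then t else if i = j then 1 else (0::real))"
      have ne: "j \<noteq> p" using j pS by auto
      have xS: "x i = (if i = j then 1 else 0)" if "i \<in> S" for i
        using that pS by (auto simp: x_def)
      have "(\<Sum>l\<in>S. W p l * x p * x l) = (\<Sum>l\<in>S. if l = j then W p j * t else 0)"
        using ne pS by (intro sum.cong refl) (auto simp: xS x_def)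
      then have 1: "(\<Sum>l\<in>S. W p l * x p * x l) = W p j * t"
        using fin j by (simp add: sum.delta')
      have "(\<Sum>i\<in>S. \<Sum>l\<in>S. W i l * x i * x l) = (\<Sum>i\<in>S. \<Sum>l\<in>S. if l = j then (if i = j then W j j else 0) else 0)"
        by (intro sum.cong) (auto simp: xS)
      then have 2: "(\<Sum>i\<in>S. \<Sum>l\<in>S. W i l * x i * x l) = W j j"
        using fin j by (simp add: sum.delta')
      have "0 \<le> 2 * (W p j * t) + W j j"
        using W[of x] split[of W x, OF symW] 1 2 True by simp
      also have "\<dots> = -1" using nz by (simp add: t_def field_simps)
      finally show False by simp
    qed
    have WS: "0 \<le> (\<Sum>i\<in>S. \<Sum>j\<in>S. W i j * x i * x j)" for x
      using W[of x] split[of W x, OF symW] 0 True by simp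
    show ?thesis
      using insert.IH[OF symW symG WS GS] split0[of W, OF symW] 0 True by simp
  next
    case False
    with Wpp have pos: "0 < W p p" by simp
    define W' where "W' = (\<lambda>i j. W i j - W p i * W p j / W p p)"
    have symW': "W' i j = W' j i" for i j using symW[of i j] by (simp add: W'_def)
    have W'S: "0 \<le> (\<Sum>i\<in>S. \<Sum>j\<in>S. W' i j * x i * x j)" for x
    proof -
      define s where "s = (\<Sum>j\<in>S. W p j * x j)"
      \<comment> \<open>Completing the square: this entry at p minimizes the form of W for given
        entries on S, and the minimum is the form of the Schur complement \<open>W'\<close> at
        x.\<close>
      define y where "y = x(p := - s / W p p)"
      have yS: "y i = x i" if "i \<in> S" for i using that pS by (auto simp: y_def)
      have a: "(\<Sum>j\<in>S. W p j * y p * y j) = y p * s"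
        unfolding s_def sum_distrib_left by (rule sum.cong) (auto simp: yS)
      have b: "(\<Sum>i\<in>S. \<Sum>j\<in>S. W i j * y i * y j) = (\<Sum>i\<in>S. \<Sum>j\<in>S. W i j * x i * x j)"
        by (intro sum.cong) (auto simp: yS)
      have "s * s = (\<Sum>i\<in>S. \<Sum>j\<in>S. (W p i * x i) * (W p j * x j))"
        unfolding s_def sum_product ..
      then have c: "(\<Sum>i\<in>S. \<Sum>j\<in>S. W' i j * x i * x j) = (\<Sum>i\<in>S. \<Sum>j\<in>S. W i j * x i * x j) - s * s / W p p"
        by (simp add: W'_def left_diff_distrib sum_subtractf sum_divide_distrib mult.assoc mult.left_commute)
      have "0 \<le> W p p * y p * y p + 2 * (y p * s) + (\<Sum>i\<in>S. \<Sum>j\<in>S. W i j * x i * x j)"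
        using W[of y] split[of W y, OF symW] a b by simp
      also have "W p p * y p * y p + 2 * (y p * s) = - (s * s / W p p)"
        using pos by (simp add: y_def field_simps)
      finally show ?thesis using c by simp
    qed
    have W'p: "W' p j = 0" for j using pos by (simp add: W'_def)
    have "0 \<le> (\<Sum>i\<in>S. \<Sum>j\<in>S. W' i j * G i j)"
      by (rule insert.IH[OF symW' symG W'S GS])
    then have "0 \<le> (\<Sum>i\<in>insert p S. \<Sum>j\<in>insert p S. W' i j * G i j)"
      using split0[of W', OF symW'] W'p by simp
    moreover have "0 \<le> (\<Sum>i\<in>insert p S. \<Sum>j\<in>insert p S. G i j * W p i * W p j) / W p p"
      using G[of "W p"] pos by simp
    moreover have "(\<Sum>i\<in>insert p S. \<Sum>j\<in>insert p S. W i j * G i j)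
       = (\<Sum>i\<in>insert p S. \<Sum>j\<in>insert p S. W' i j * G i j)
         + (\<Sum>i\<in>insert p S. \<Sum>j\<in>insert p S. G i j * W p i * W p j) / W p p"
      unfolding sum_divide_distrib sum.distrib[symmetric]
      by (intro sum.cong refl) (simp add: W'_def algebra_simps)
    ultimately show ?thesis by simp
  qed
qed

text \<open>A causal convolution only sees a lower triangular matrix. Adding the transpose gives a
  symmetric Toeplitz matrix whose double sum is twice the triangular one; the diagonal lies in both
  halves, hence the entry \<open>2 * w 0\<close>. The Schur product then applies to this
  matrix.\<close>

lemma convolution_psd_nonneg:
  fixes w :: "nat \<Rightarrow> real" and G :: "nat \<Rightarrow> nat \<Rightarrow> real"
  assumes symG: "\<And>i j. G i j = G j i"
    and w: "\<And>a. 0 \<le> (\<Sum>n=1..N. \<Sum>l=1..n. w (n - l) * a l * a n)"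
    and G: "\<And>x. 0 \<le> (\<Sum>i=1..N. \<Sum>j=1..N. G i j * x i * x j)"
  shows "0 \<le> (\<Sum>n=1..N. \<Sum>l=1..n. w (n - l) * G l n)"
proof -
  define W where "W = (\<lambda>i j. if i < j then w (j - i) else if j < i then w (i - j) else 2 * w 0)"
  have symW: "W i j = W j i" for i j by (simp add: W_def)
  have *: "(\<Sum>i=1..N. \<Sum>j=1..N. W i j * H i j) = 2 * (\<Sum>n=1..N. \<Sum>l=1..n. w (n - l) * H l n)"
    if H: "\<And>i j. H i j = H j i" for H
  proof -
    define L where "L = (\<lambda>i j. if j \<le> i then w (i - j) * H j i else 0)"
    have "W i j * H i j = L i j + L j i" for i j
      using H[of i j] by (auto simp: W_def L_def)
    then have "(\<Sum>i=1..N. \<Sum>j=1..N. W i j * H i j) = (\<Sum>i=1..N. \<Sum>j=1..N. L i j) + (\<Sum>i=1..N. \<Sum>j=1..N. L j i)"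
      by (simp add: sum.distrib)
    also have "(\<Sum>i=1..N. \<Sum>j=1..N. L j i) = (\<Sum>i=1..N. \<Sum>j=1..N. L i j)"
      by (rule sum.swap)
    also have "(\<Sum>i=1..N. \<Sum>j=1..N. L i j) = (\<Sum>n=1..N. \<Sum>l=1..n. w (n - l) * H l n)"
    proof (rule sum.cong[OF refl])
      fix i assume "i \<in> {1..N}"
      then show "(\<Sum>j=1..N. L i j) = (\<Sum>l=1..i. w (i - l) * H l i)"
        by (intro sum.mono_neutral_cong_right) (auto simp: L_def)
    qed
    finally show ?thesis by simp
  qed
  have W: "0 \<le> (\<Sum>i=1..N. \<Sum>j=1..N. W i j * x i * x j)" for x
    using *[of "\<lambda>i j. x i * x j"] w[of x] by (simp add: mult.assoc)
  show ?thesis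
    using sum_psd_products_nonneg[of "{1..N}" W G, OF _ symW symG W G] *[of G, OF symG] by simp
qed

section \<open>Positivity of the quadrature weights\<close>

lemma integral_zero_outside:
  fixes f :: "'a::euclidean_space \<Rightarrow> 'b::banach"
  assumes "S \<subseteq> T" "\<And>x. x \<in> T - S \<Longrightarrow> f x = 0"
  shows "integral T f = integral S f"
proof -
  have "integral T f = integral T (\<lambda>x. if x \<in> S then f x else 0)"
    using assms(2) by (intro integral_cong) auto
  also have "\<dots> = integral (S \<inter> T) f" by (rule integral_restrict_Int)
  also have "S \<inter> T = S" using assms(1) by auto
  finally show ?thesis .
qed

lemma integral_diff_substitution:
  fixes f :: "real \<Rightarrow> 'b::euclidean_space"
  shows "integral {a..b} (\<lambda>x. f (c - x)) = integral {c - b..c - a} f"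
proof -
  have "integral {c - b..c - a} f = integral {(c - b) - c..(c - a) - c} (\<lambda>x. f (x + c))"
    by (simp only: integral_shift_real_ivl)
  also have "\<dots> = integral {- b..- a} (\<lambda>x. f (c - (- x)))" by (simp add: add.commute)
  also have "\<dots> = integral {a..b} (\<lambda>x. f (c - x))"
    using Henstock_Kurzweil_Integration.integral_reflect_real[of b a "\<lambda>x. f (c - x)"] by simp
  finally show ?thesis ..
qed

lemma has_integral_diff_substitution:
  fixes f :: "real \<Rightarrow> 'b::real_normed_vector"
  assumes "(f has_integral I) {c - b..c - a}"
  shows "((\<lambda>x. f (c - x)) has_integral I) {a..b}"
proof -
  have "((\<lambda>x. f (x + c)) has_integral I) {- b..- a}"
    using has_integral_shift_real_ivl[OF assms, of c] by simp
  then have "((\<lambda>x. (\<lambda>y. f (c - y)) (- x)) has_integral I) {- b..- a}"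
    by (simp add: add.commute)
  then show ?thesis
    by (rule has_integral_reflect_real[where f = "\<lambda>y. f (c - y)", THEN iffD1])
qed

lemma absolutely_integrable_mult_continuous:
  fixes \<beta> :: "real \<Rightarrow> real"
  assumes "\<beta> absolutely_integrable_on {a..b}" "continuous_on {a..b} g"
  shows "(\<lambda>s. \<beta> s * g s) absolutely_integrable_on {a..b}"
proof -
  have "(\<lambda>s. g s * \<beta> s) absolutely_integrable_on {a..b}"
  proof (rule absolutely_integrable_bounded_measurable_product_real)
    show "g \<in> borel_measurable (lebesgue_on {a..b})"
      by (rule continuous_imp_measurable_on_sets_lebesgue) (use assms in auto)
    show "bounded (g ` {a..b})"
      by (intro compact_imp_bounded compact_continuous_image assms(2)) simp
  qed (use assms in auto)
  then show ?thesis by (simp add: mult.commute)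
qed

section \<open>Iterated primitives of an integrable kernel\<close>

definition primitive :: "(real \<Rightarrow> real) \<Rightarrow> real \<Rightarrow> real" where
  "primitive \<beta> x = integral {0..x} \<beta>"

text \<open>Cauchy's formula for repeated integration, so a second antiderivative of \<beta> as a
  single integral. For x \<le> 0 the value is 0, a convention that later encodes causality.\<close>

definition primitive2 :: "(real \<Rightarrow> real) \<Rightarrow> real \<Rightarrow> real" where
  "primitive2 \<beta> x = integral {0..x} (\<lambda>s. \<beta> s * (x - s))"

lemma primitive2_nonpos: "x \<le> 0 \<Longrightarrow> primitive2 \<beta> x = 0"
  by (cases "x = 0") (auto simp: primitive2_def)

text \<open>The ramp moves the dependence on x from the interval into the integrand, so that
  differences of values at several points become one integral over a common interval.\<close>

lemma primitive2_eq:
  assumes "x \<le> X"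
  shows "primitive2 \<beta> x = integral {0..X} (\<lambda>s. \<beta> s * max 0 (x - s))"
proof -
  have "integral {0..X} (\<lambda>s. \<beta> s * max 0 (x - s)) = integral {0..x} (\<lambda>s. \<beta> s * max 0 (x - s))"
    using assms by (intro integral_zero_outside) auto
  also have "\<dots> = primitive2 \<beta> x" unfolding primitive2_def
    by (rule integral_cong) auto
  finally show ?thesis ..
qed

lemma mult_ramp_integrable:
  fixes \<beta> :: "real \<Rightarrow> real"
  assumes "\<beta> absolutely_integrable_on {0..X}"
  shows "(\<lambda>s. \<beta> s * max 0 (x - s)) integrable_on {0..X}"
  by (intro set_lebesgue_integral_eq_integral(1) absolutely_integrable_mult_continuous assms
      continuous_intros)

text \<open>The ramp is 1-Lipschitz in x. The constant is uniform in the step of a difference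
  quotient, which later provides the dominating bound when steps tend to 0.\<close>

lemma primitive2_lipschitz:
  assumes \<beta>: "\<beta> absolutely_integrable_on {0..X}" and "x \<le> X" "y \<le> X"
  shows "\<bar>primitive2 \<beta> x - primitive2 \<beta> y\<bar> \<le> integral {0..X} (\<lambda>s. \<bar>\<beta> s\<bar>) * \<bar>x - y\<bar>"
proof -
  have int: "(\<lambda>s. \<beta> s * max 0 (z - s)) integrable_on {0..X}" for z
    by (rule mult_ramp_integrable[OF \<beta>])
  have "primitive2 \<beta> x - primitive2 \<beta> y = integral {0..X} (\<lambda>s. \<beta> s * max 0 (x - s) - \<beta> s * max 0 (y - s))"
    using assms int by (simp add: primitive2_eq integral_diff)
  also have "norm \<dots> \<le> integral {0..X} (\<lambda>s. \<bar>\<beta> s\<bar> * \<bar>x - y\<bar>)"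
  proof (rule integral_norm_bound_integral)
    show "(\<lambda>s. \<beta> s * max 0 (x - s) - \<beta> s * max 0 (y - s)) integrable_on {0..X}"
      by (intro integrable_diff int)
    show "(\<lambda>s. \<bar>\<beta> s\<bar> * \<bar>x - y\<bar>) integrable_on {0..X}"
      using \<beta> by (intro integrable_on_mult_left) (simp add: absolutely_integrable_on_def)
    fix s
    have "norm (\<beta> s * max 0 (x - s) - \<beta> s * max 0 (y - s)) = \<bar>\<beta> s\<bar> * \<bar>max 0 (x - s) - max 0 (y - s)\<bar>"
      by (simp add: abs_mult right_diff_distrib[symmetric])
    also have "\<dots> \<le> \<bar>\<beta> s\<bar> * \<bar>x - y\<bar>" by (intro mult_left_mono) auto
    finally show "norm (\<beta> s * max 0 (x - s) - \<beta> s * max 0 (y - s)) \<le> \<bar>\<beta> s\<bar> * \<bar>x - y\<bar>" .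
  qed
  finally show ?thesis by simp
qed

text \<open>The kernel need not be continuous, so its primitive need not be differentiable; the second
  primitive still is, because its difference quotients converge dominatedly.\<close>

lemma primitive2_has_derivative:
  assumes \<beta>: "\<And>X. \<beta> absolutely_integrable_on {0..X}"
  shows "(primitive2 \<beta> has_real_derivative primitive \<beta> x) (at x)"
  unfolding has_field_derivative_iff tendsto_at_iff_sequentially comp_def
proof (intro allI impI)
  fix y :: "nat \<Rightarrow> real"
  assume "\<forall>i. y i \<in> UNIV - {x}" and lim: "y \<longlonglongrightarrow> x"
  then have ne: "y i \<noteq> x" for i by auto
  have "Bseq y" using lim convergent_def convergent_imp_Bseq by blast
  then obtain X0 where X0: "\<And>i. \<bar>y i\<bar> \<le> X0" by (auto simp: Bseq_def)
  define X where "X = max X0 x"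
  have yX: "y i \<le> X" for i using X0[of i] by (auto simp: X_def)
  have xX: "x \<le> X" by (simp add: X_def)
  define q where "q = (\<lambda>i s. (max 0 (y i - s) - max 0 (x - s)) / (y i - x))"
  have q1: "\<bar>q i s\<bar> \<le> 1" for i s
    using ne[of i] by (auto simp: q_def abs_if field_simps max_def)
  have qlim: "(\<lambda>i. q i s) \<longlonglongrightarrow> (if s < x then 1 else 0)" if "s \<noteq> x" for s
  proof (cases "s < x")
    case True
    then have "\<forall>\<^sub>F i in sequentially. s < y i" using lim by (intro order_tendstoD)
    then have "\<forall>\<^sub>F i in sequentially. q i s = 1"
      by eventually_elim (use True ne in \<open>auto simp: q_def\<close>)
    then show ?thesis using True by (simp add: tendsto_eventually)
  next
    case False
    then have "\<forall>\<^sub>F i in sequentially. y i < s" using lim that by (intro order_tendstoD) auto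
    then have "\<forall>\<^sub>F i in sequentially. q i s = 0"
      by eventually_elim (use False ne in \<open>auto simp: q_def\<close>)
    then show ?thesis using False by (simp add: tendsto_eventually)
  qed
  \<comment> \<open>At s = x the quotient is 1 or 0 according to the side from which y i approaches,
    so it need not converge. This single point is overwritten by 0.\<close>
  define f where "f = (\<lambda>i s. if s = x then 0 else \<beta> s * q i s)"
  define g where "g = (\<lambda>s. if s < x then \<beta> s else 0)"
  have int: "(\<lambda>s. \<beta> s * q i s) integrable_on {0..X}" for i
    unfolding q_def
    by (intro set_lebesgue_integral_eq_integral(1) absolutely_integrable_mult_continuous \<beta>
      continuous_intros) (use ne in auto)
  have quot: "(primitive2 \<beta> (y i) - primitive2 \<beta> x) / (y i - x) = integral {0..X} (f i)" for i
  proof -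
    have "(primitive2 \<beta> (y i) - primitive2 \<beta> x) / (y i - x)
        = integral {0..X} (\<lambda>s. (\<beta> s * max 0 (y i - s) - \<beta> s * max 0 (x - s)) / (y i - x))"
      by (simp add: primitive2_eq[OF yX] primitive2_eq[OF xX] integral_diff mult_ramp_integrable \<beta>)
    also have "\<dots> = integral {0..X} (\<lambda>s. \<beta> s * q i s)"
      by (simp add: q_def right_diff_distrib[symmetric])
    also have "\<dots> = integral {0..X} (f i)"
      by (rule integral_spike[of "{x}"]) (auto simp: f_def)
    finally show ?thesis .
  qed
  have "(\<lambda>i. integral {0..X} (f i)) \<longlonglongrightarrow> integral {0..X} g"
  proof (rule dominated_convergence(2))
    show "f i integrable_on {0..X}" for i
      by (rule integrable_spike[OF int[of i], of "{x}"]) (auto simp: f_def)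
    show "(\<lambda>s. \<bar>\<beta> s\<bar>) integrable_on {0..X}"
      using \<beta>[of X] by (simp add: absolutely_integrable_on_def)
    show "norm (f i s) \<le> \<bar>\<beta> s\<bar>" for i s
      using mult_left_mono[OF q1[of i s], of "\<bar>\<beta> s\<bar>"] by (simp add: f_def abs_mult)
    show "(\<lambda>i. f i s) \<longlonglongrightarrow> g s" for s
      using tendsto_mult_left[OF qlim, of s "\<beta> s"]
      by (cases "s = x"; cases "s < x") (simp_all add: f_def g_def)
  qed
  moreover have "integral {0..X} g = primitive \<beta> x"
  proof -
    have "integral {0..X} g = integral {0..x} g"
      using xX by (intro integral_zero_outside) (auto simp: g_def)
    also have "\<dots> = primitive \<beta> x" unfolding primitive_def
      by (rule integral_spike[of "{x}"]) (auto simp: g_def)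
    finally show ?thesis .
  qed
  ultimately show "(\<lambda>i. (primitive2 \<beta> (y i) - primitive2 \<beta> x) / (y i - x)) \<longlonglongrightarrow> primitive \<beta> x"
    by (simp add: quot)
qed

text \<open>Up to the factor k, the hat function is the second difference with step k of the ramp.
  Integration against \<beta> turns ramps into values of \<open>primitive2 \<beta>\<close>.\<close>

lemma weight_eq_second_difference:
  assumes \<beta>: "\<And>X. \<beta> absolutely_integrable_on {0..X}" and k: "k > 0"
  shows "k * weight k \<beta> j = primitive2 \<beta> (real j * k + k) - 2 * primitive2 \<beta> (real j * k)
     + primitive2 \<beta> (real j * k - k)"
proof -
  define t where "t = real j * k"
  define X where "X = t + k"
  have t0: "t \<ge> 0" using k by (simp add: t_def)
  have "weight k \<beta> j = integral {- k..min k t} (\<lambda>\<zeta>. (\<lambda>s. \<beta> s * hat ((t - s) / k)) (t - \<zeta>))"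
    unfolding weight_def t_def by simp
  also have "\<dots> = integral {t - min k t..X} (\<lambda>s. \<beta> s * hat ((t - s) / k))"
    unfolding X_def by (subst integral_diff_substitution) simp
  \<comment> \<open>For j = 0 the lower limit is already 0. For j \<ge> 1 it is t - k, and the hat
    vanishes below.\<close>
  also have "\<dots> = integral {0..X} (\<lambda>s. \<beta> s * hat ((t - s) / k))"
    by (rule integral_zero_outside[symmetric]) (use k t0 in \<open>auto simp: hat_def field_simps\<close>)
  finally have "k * weight k \<beta> j = integral {0..X} (\<lambda>s. k * (\<beta> s * hat ((t - s) / k)))"
    by simp
  also have "\<dots> = integral {0..X} (\<lambda>s. \<beta> s * max 0 (t + k - s) - 2 * (\<beta> s * max 0 (t - s)) + \<beta> s * max 0 (t - k - s))"
  proof (rule integral_cong)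
    fix s
    have "k * hat ((t - s) / k) = max (k - \<bar>t - s\<bar>) 0"
      using k by (auto simp: hat_def max_def field_simps)
    also have "\<dots> = max 0 (t + k - s) - 2 * max 0 (t - s) + max 0 (t - k - s)"
      using k by (auto simp: max_def)
    finally have eq: "k * hat ((t - s) / k) = \<dots>" .
    have "k * (\<beta> s * hat ((t - s) / k)) = \<beta> s * (k * hat ((t - s) / k))" by simp
    then show "k * (\<beta> s * hat ((t - s) / k)) =
      \<beta> s * max 0 (t + k - s) - 2 * (\<beta> s * max 0 (t - s)) + \<beta> s * max 0 (t - k - s)"
      unfolding eq by (simp only: distrib_left right_diff_distrib mult.left_commute)
  qed
  also have "\<dots> = primitive2 \<beta> (t + k) - 2 * primitive2 \<beta> t + primitive2 \<beta> (t - k)"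
    using k by (simp add: primitive2_eq[of _ X] X_def integral_add integral_diff mult_ramp_integrable \<beta>
        integrable_diff integrable_on_cmult_left)
  finally show ?thesis by (simp add: t_def)
qed

text \<open>The hat is, up to scaling, the convolution of two cell indicators: integrating \<beta>(t
  - s) over t in cell n and s in cell l with s < t gives exactly
  \<open>k * weight k \<beta> (n - l)\<close>, and for l = n the restriction s < t matches the cut
  of the integration interval in \<open>weight\<close>. The sum is thus 1/k times the positive type
  form at the step function with values a l. Positive type gives the inequality for continuous
  approximations, and dominated convergence carries it over.\<close>

lemma positive_type_convolution_nonneg:
  fixes a :: "nat \<Rightarrow> real"
  assumes \<beta>: "\<And>X. \<beta> absolutely_integrable_on {0..X}" and pos: "positive_type \<beta>" and k: "k > 0"
  shows "0 \<le> (\<Sum>n=1..N. \<Sum>l=1..n. weight k \<beta> (n - l) * a l * a n)"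
proof (cases "N = 0")
  case True
  then show ?thesis by simp
next
  case False
  define F where "F = primitive2 \<beta>"
  define V where "V = primitive \<beta>"
  define T where "T = real N * k"
  have T: "T > 0" using False k by (simp add: T_def)
  \<comment> \<open>\<open>p l\<close> and \<open>p' l\<close> are the two ends of the l-th
    cell.\<close>
  define p where "p = (\<lambda>l::nat. real l * k - k)"
  define p' where "p' = (\<lambda>l::nat. real l * k)"
  define m :: "nat \<Rightarrow> real" where "m = (\<lambda>i. real (Suc i))"
  have m0: "m i > 0" "1 / m i > 0" for i by (simp_all add: m_def)
  have Fc: "continuous_on S F" for S
    unfolding F_def
    by (rule DERIV_continuous_on) (rule has_field_derivative_at_within[OF primitive2_has_derivative[OF \<beta>]])
  \<comment> \<open>The step function taking the value \<open>a l\<close> on the \<open>l\<close>-th interval is the limit of these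
    continuous ramps; their convolutions with \<open>\<beta>\<close> are difference quotients of \<open>F\<close>.\<close>
  define \<rho> where "\<rho> = (\<lambda>i x. m i * (max 0 x - max 0 (x - 1 / m i)))"
  define R where "R = (\<lambda>i x. m i * (F x - F (x - 1 / m i)))"
  define st where "st = (\<lambda>x::real. if x > 0 then 1 else (0::real))"
  define \<phi> where "\<phi> = (\<lambda>i s. \<Sum>l=1..N. a l * (\<rho> i (s - p l) - \<rho> i (s - p' l)))"
  define c where "c = (\<lambda>i t. \<Sum>l=1..N. a l * (R i (t - p l) - R i (t - p' l)))"
  define \<Phi> where "\<Phi> = (\<lambda>s. \<Sum>l=1..N. a l * (st (s - p l) - st (s - p' l)))"
  define C where "C = (\<lambda>t. \<Sum>l=1..N. a l * (V (t - p l) - V (t - p' l)))"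
  have \<rho>c: "continuous_on S (\<lambda>s. \<rho> i (s - x))" for S i x
    unfolding \<rho>_def by (intro continuous_intros)
  have \<phi>c: "continuous_on S (\<phi> i)" for S i
    unfolding \<phi>_def by (intro continuous_intros \<rho>c)
  have Fc': "continuous_on S (\<lambda>t. F (t - x))" for S x
    by (rule continuous_on_compose2[OF Fc]) (auto intro!: continuous_intros)
  have Rc: "continuous_on S (\<lambda>t. R i (t - x))" for S i x
    unfolding R_def diff_diff_eq by (intro continuous_intros Fc')
  have cc: "continuous_on S (c i)" for S i
    unfolding c_def by (intro continuous_intros Rc)
  have conv\<rho>: "((\<lambda>s. \<beta> s * \<rho> i (t - s - x)) has_integral R i (t - x)) {0..t}"
    if "t \<ge> 0" "x \<ge> 0" for i t x
  proof -
    have *: "((\<lambda>s. \<beta> s * max 0 (z - s)) has_integral F z) {0..t}" if "z \<le> t" for z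
      using mult_ramp_integrable[OF \<beta>] primitive2_eq[OF that, of \<beta>]
      by (simp add: F_def has_integral_integral)
    have "((\<lambda>s. m i * (\<beta> s * max 0 (t - x - s) - \<beta> s * max 0 (t - x - 1 / m i - s)))
      has_integral R i (t - x)) {0..t}"
    proof -
      have "t - x \<le> t" "t - x - 1 / m i \<le> t" using that m0(2)[of i] by linarith+
      then show ?thesis unfolding R_def by (intro has_integral_mult_right has_integral_diff *)
    qed
    then show ?thesis by (simp add: \<rho>_def algebra_simps)
  qed
  have p0: "p l \<ge> 0" "p' l \<ge> 0" if "l \<in> {1..N}" for l
    using that k by (auto simp: p_def p'_def)
  have conv: "integral {0..t} (\<lambda>s. \<beta> (t - s) * \<phi> i s) = c i t" if "t \<ge> 0" for i t
  proof -
    have "integral {0..t} (\<lambda>s. \<beta> (t - s) * \<phi> i s) = integral {0..t} (\<lambda>s. \<beta> s * \<phi> i (t - s))"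
      using integral_diff_substitution[of 0 t "\<lambda>s. \<beta> s * \<phi> i (t - s)" t] by simp
    also have "\<dots> = c i t"
    proof (rule integral_unique)
      have "((\<lambda>s. \<Sum>l=1..N. a l * (\<beta> s * \<rho> i (t - s - p l) - \<beta> s * \<rho> i (t - s - p' l)))
         has_integral c i t) {0..t}"
        unfolding c_def
        by (intro has_integral_sum has_integral_mult_right has_integral_diff conv\<rho> that p0) auto
      then show "((\<lambda>s. \<beta> s * \<phi> i (t - s)) has_integral c i t) {0..t}"
        by (simp add: \<phi>_def sum_distrib_left algebra_simps)
    qed
    finally show ?thesis .
  qed
  have nonneg: "0 \<le> integral {0..T} (\<lambda>t. \<phi> i t * c i t)" for i
  proof -
    have "0 \<le> integral {0..T} (\<lambda>t. \<phi> i t * integral {0..t} (\<lambda>s. \<beta> (t - s) * \<phi> i s))"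
      using pos T \<phi>c unfolding positive_type_def by blast
    also have "\<dots> = integral {0..T} (\<lambda>t. \<phi> i t * c i t)"
      by (rule integral_cong) (simp add: conv)
    finally show ?thesis .
  qed
  define L where "L = integral {0..T} (\<lambda>s. \<bar>\<beta> s\<bar>)"
  have \<rho>1: "0 \<le> \<rho> i x" "\<rho> i x \<le> 1" for i x
  proof -
    define d where "d = max 0 x - max 0 (x - 1 / m i)"
    have "0 \<le> max 0 x - max 0 (x - r) \<and> max 0 x - max 0 (x - r) \<le> r" if "r > 0" for r
      using that by (auto simp: max_def)
    from this[OF m0(2)] have d: "0 \<le> d" "d \<le> 1 / m i" by (auto simp: d_def)
    have "m i * d \<le> m i * (1 / m i)" using m0(1)[of i] d by (intro mult_left_mono) auto
    then show "0 \<le> \<rho> i x" "\<rho> i x \<le> 1"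
      using m0(1)[of i] d by (simp_all add: \<rho>_def d_def[symmetric])
  qed
  have \<phi>1: "\<bar>\<phi> i t\<bar> \<le> (\<Sum>l=1..N. \<bar>a l\<bar>)" for i t
    unfolding \<phi>_def
  proof (rule order_trans[OF sum_abs sum_mono])
    fix l
    have "\<bar>\<rho> i (t - p l) - \<rho> i (t - p' l)\<bar> \<le> 1"
      using \<rho>1[of i "t - p l"] \<rho>1[of i "t - p' l"] by linarith
    from mult_left_mono[OF this abs_ge_zero[of "a l"]]
    show "\<bar>a l * (\<rho> i (t - p l) - \<rho> i (t - p' l))\<bar> \<le> \<bar>a l\<bar>" by (simp add: abs_mult)
  qed
  have R1: "\<bar>R i x\<bar> \<le> L" if "x \<le> T" for i x
  proof -
    have "\<bar>F x - F (x - 1 / m i)\<bar> \<le> L * \<bar>x - (x - 1 / m i)\<bar>"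
    proof -
      have "x - 1 / m i \<le> T" using that m0(2)[of i] by linarith
      then show ?thesis unfolding F_def L_def by (intro primitive2_lipschitz \<beta> that)
    qed
    also have "\<dots> = L / m i" using m0(1)[of i] by simp
    finally have "m i * \<bar>F x - F (x - 1 / m i)\<bar> \<le> m i * (L / m i)"
      using m0(1)[of i] by (intro mult_left_mono) auto
    then show ?thesis using m0(1)[of i] by (simp add: R_def abs_mult)
  qed
  have c1: "\<bar>c i t\<bar> \<le> (\<Sum>l=1..N. \<bar>a l\<bar> * (2 * L))" if "t \<le> T" for i t
    unfolding c_def
  proof (rule order_trans[OF sum_abs sum_mono])
    fix l assume l: "l \<in> {1..N}"
    have "\<bar>R i (t - p l) - R i (t - p' l)\<bar> \<le> 2 * L"
      using R1[of "t - p l" i] R1[of "t - p' l" i] p0[OF l] that by linarith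
    from mult_left_mono[OF this abs_ge_zero[of "a l"]]
    show "\<bar>a l * (R i (t - p l) - R i (t - p' l))\<bar> \<le> \<bar>a l\<bar> * (2 * L)" by (simp add: abs_mult)
  qed
  have minv: "(\<lambda>i. 1 / m i) \<longlonglongrightarrow> 0"
    unfolding m_def using LIMSEQ_inverse_real_of_nat by (simp add: inverse_eq_divide)
  have \<rho>lim: "(\<lambda>i. \<rho> i x) \<longlonglongrightarrow> st x" for x
  proof (cases "x > 0")
    case True
    have "\<forall>\<^sub>F i in sequentially. 1 / m i < x" using minv True by (intro order_tendstoD)
    then have "\<forall>\<^sub>F i in sequentially. \<rho> i x = 1"
    proof eventually_elim
      case (elim i)
      have "max 0 x = x" "max 0 (x - 1 / m i) = x - 1 / m i" using True elim by simp_all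
      then show ?case using m0(1)[of i] by (simp add: \<rho>_def)
    qed
    then show ?thesis using True by (simp add: st_def tendsto_eventually)
  next
    case False
    have "\<rho> i x = 0" for i
    proof -
      have "x - 1 / m i \<le> 0" using False m0(2)[of i] by linarith
      then show ?thesis using False by (simp add: \<rho>_def)
    qed
    then show ?thesis using False by (simp add: st_def)
  qed
  have Rlim: "(\<lambda>i. R i x) \<longlonglongrightarrow> V x" for x
  proof -
    have "((\<lambda>y. (F y - F x) / (y - x)) \<longlongrightarrow> V x) (at x)"
      using primitive2_has_derivative[OF \<beta>, of x] unfolding has_field_derivative_iff F_def V_def .
    moreover have "filterlim (\<lambda>i. x - 1 / m i) (at x) sequentially"
      using tendsto_diff[OF tendsto_const[of x] minv] m0(1)
      by (auto simp: filterlim_at less_imp_neq[symmetric])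
    ultimately have "(\<lambda>i. (F (x - 1 / m i) - F x) / (x - 1 / m i - x)) \<longlonglongrightarrow> V x"
      by (rule filterlim_compose)
    moreover have "(F (x - 1 / m i) - F x) / (x - 1 / m i - x) = R i x" for i
      using m0[of i] by (simp add: R_def field_simps)
    ultimately show ?thesis by simp
  qed
  have "(\<lambda>i. integral {0..T} (\<lambda>t. \<phi> i t * c i t)) \<longlonglongrightarrow> integral {0..T} (\<lambda>t. \<Phi> t * C t)"
  proof (rule dominated_convergence(2))
    show "(\<lambda>t. \<phi> i t * c i t) integrable_on {0..T}" for i
      by (intro integrable_continuous_interval continuous_intros \<phi>c cc)
    show "(\<lambda>t. (\<Sum>l=1..N. \<bar>a l\<bar>) * (\<Sum>l=1..N. \<bar>a l\<bar> * (2 * L))) integrable_on {0..T}"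
      by (intro integrable_continuous_interval continuous_intros)
    show "norm (\<phi> i t * c i t) \<le> (\<Sum>l=1..N. \<bar>a l\<bar>) * (\<Sum>l=1..N. \<bar>a l\<bar> * (2 * L))"
      if "t \<in> {0..T}" for i t
      unfolding real_norm_def abs_mult
      by (intro mult_mono \<phi>1 c1) (use that in \<open>auto intro!: sum_nonneg\<close>)
    show "(\<lambda>i. \<phi> i t * c i t) \<longlonglongrightarrow> \<Phi> t * C t" for t
      unfolding \<phi>_def c_def \<Phi>_def C_def by (intro tendsto_intros \<rho>lim Rlim)
  qed
  then have lim: "0 \<le> integral {0..T} (\<lambda>t. \<Phi> t * C t)"
    by (rule LIMSEQ_le_const) (use nonneg in auto)
  define I where "I = (\<lambda>n. \<Sum>l=1..N. a l * ((F (p' n - p l) - F (p' n - p' l)) - (F (p n - p l) - F (p n - p' l))))"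
  have intC: "(C has_integral I n) {p n..p' n}" for n
  proof -
    have "(C has_integral (\<Sum>l=1..N. a l * (F (p' n - p l) - F (p' n - p' l)))
            - (\<Sum>l=1..N. a l * (F (p n - p l) - F (p n - p' l)))) {p n..p' n}"
    proof (rule fundamental_theorem_of_calculus)
      show "p n \<le> p' n" using k by (simp add: p_def p'_def)
      have d: "((\<lambda>t. F (t - x)) has_real_derivative V (t - x)) (at t within S)" for t x S
      proof -
        have "((\<lambda>t. t - x) has_real_derivative 1) (at t within S)"
          by (auto intro!: derivative_eq_intros)
        from DERIV_chain2[OF primitive2_has_derivative[OF \<beta>, of "t - x", folded F_def V_def] this]
        show ?thesis by simp
      qed
      show "((\<lambda>t. \<Sum>l=1..N. a l * (F (t - p l) - F (t - p' l))) has_vector_derivative C t)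
        (at t within {p n..p' n})" for t
        unfolding has_real_derivative_iff_has_vector_derivative[symmetric] C_def
        by (intro DERIV_sum DERIV_cmult DERIV_diff d)
    qed
    then show ?thesis by (simp add: I_def sum_subtractf[symmetric] right_diff_distrib)
  qed
  have "((\<lambda>t. \<Phi> t * C t) has_integral (\<Sum>n=1..N. a n * I n)) {0..T}"
  proof -
    have 1: "((\<lambda>t. (st (t - p n) - st (t - p' n)) * C t) has_integral I n) {0..T}"
      if n: "n \<in> {1..N}" for n
    proof -
      have "p' n \<le> T" using n k unfolding p'_def T_def by (intro mult_right_mono) auto
      then have sub: "{p n..p' n} \<subseteq> {0..T}" using p0[OF n] by auto
      have "((\<lambda>t. if t \<in> {p n..p' n} then C t else 0) has_integral I n) {0..T}"
        using intC[of n] by (subst has_integral_restrict[OF sub])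
      then show ?thesis
        \<comment> \<open>Since \<open>st 0 = 0\<close>, the difference of the two jumps is the
          indicator of the cell without its left end, and only that point has to be
          disregarded.\<close>
        by (rule has_integral_spike_finite[of "{p n}", rotated 2])
          (use k in \<open>auto simp: st_def p_def p'_def\<close>)
    qed
    have "((\<lambda>t. \<Sum>n=1..N. a n * ((st (t - p n) - st (t - p' n)) * C t)) has_integral (\<Sum>n=1..N. a n * I n)) {0..T}"
      by (intro has_integral_sum has_integral_mult_right 1) auto
    then show ?thesis by (simp add: \<Phi>_def sum_distrib_right mult.assoc)
  qed
  then have "integral {0..T} (\<lambda>t. \<Phi> t * C t) = (\<Sum>n=1..N. a n * I n)"
    by (rule integral_unique)
  also have "\<dots> = k * (\<Sum>n=1..N. \<Sum>l=1..n. weight k \<beta> (n - l) * a l * a n)"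
    unfolding sum_distrib_left
  proof (rule sum.cong[OF refl])
    fix n assume n: "n \<in> {1..N}"
    define d where "d = (\<lambda>l. (F (p' n - p l) - F (p' n - p' l)) - (F (p n - p l) - F (p n - p' l)))"
    \<comment> \<open>Causality: cell l lies after cell n, so all four arguments are nonpositive and
      F vanishes there.\<close>
    have "d l = 0" if "n < l" for l
    proof -
      have "real n + 1 \<le> real l" using that by simp
      from mult_right_mono[OF this, of k] k have "p' n + k \<le> p' l" by (simp add: p'_def algebra_simps)
      then have "p' n - p l \<le> 0" "p' n - p' l \<le> 0" "p n - p l \<le> 0" "p n - p' l \<le> 0"
        using k unfolding p_def p'_def by linarith+
      then show ?thesis by (simp only: d_def F_def primitive2_nonpos)
    qed
    then have "(\<Sum>l=1..N. a l * d l) = (\<Sum>l=1..n. a l * d l)"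
      using n by (intro sum.mono_neutral_right) auto
    moreover have "I n = (\<Sum>l=1..N. a l * d l)" by (simp only: I_def d_def)
    ultimately have "I n = (\<Sum>l=1..n. a l * d l)" by simp
    also have "\<dots> = (\<Sum>l=1..n. a l * (k * weight k \<beta> (n - l)))"
    proof (rule sum.cong[OF refl])
      fix l assume "l \<in> {1..n}"
      then have *: "real (n - l) = real n - real l" by auto
      show "a l * d l = a l * (k * weight k \<beta> (n - l))"
        unfolding weight_eq_second_difference[OF \<beta> k] * d_def p_def p'_def F_def
        by (simp add: algebra_simps)
    qed
    finally show "a n * I n = (\<Sum>l=1..n. k * (weight k \<beta> (n - l) * a l * a n))"
      by (simp add: sum_distrib_left algebra_simps)
  qed
  finally show ?thesis using lim k by (simp add: zero_le_mult_iff)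
qed

section \<open>Stability of the scheme\<close>

lemma positive_selfadjoint_zero:
  assumes "positive_selfadjoint D B"
  shows "0 \<in> D" "B 0 = 0"
proof -
  show 0: "0 \<in> D" using assms by (simp add: positive_selfadjoint_def subspace_def)
  have "B (0 *\<^sub>R 0) = 0 *\<^sub>R B 0" using assms 0 unfolding positive_selfadjoint_def by blast
  then show "B 0 = 0" by simp
qed

lemma positive_selfadjoint_add:
  "positive_selfadjoint D B \<Longrightarrow> x \<in> D \<Longrightarrow> y \<in> D \<Longrightarrow> x + y \<in> D \<and> B (x + y) = B x + B y"
  by (simp add: positive_selfadjoint_def subspace_def)

lemma positive_selfadjoint_scale:
  "positive_selfadjoint D B \<Longrightarrow> x \<in> D \<Longrightarrow> r *\<^sub>R x \<in> D \<and> B (r *\<^sub>R x) = r *\<^sub>R B x"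
  by (simp add: positive_selfadjoint_def subspace_def)

lemma positive_selfadjoint_diff:
  assumes "positive_selfadjoint D B" "x \<in> D" "y \<in> D"
  shows "x - y \<in> D \<and> B (x - y) = B x - B y"
  using positive_selfadjoint_add[OF assms(1,2), of "(-1) *\<^sub>R y"]
    positive_selfadjoint_scale[OF assms(1,3), of "-1"] by simp

lemma positive_selfadjoint_sum:
  assumes B: "positive_selfadjoint D B" and x: "\<And>i. i \<in> S \<Longrightarrow> x i \<in> D"
  shows "(\<Sum>i\<in>S. x i) \<in> D \<and> B (\<Sum>i\<in>S. x i) = (\<Sum>i\<in>S. B (x i))"
  using x
proof (induction S rule: infinite_finite_induct)
  case (insert i S)
  then show ?case using positive_selfadjoint_add[OF B, of "x i" "\<Sum>i\<in>S. x i"] by simp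
qed (use positive_selfadjoint_zero[OF B] in simp_all)

lemma positive_selfadjoint_symmetric:
  assumes "positive_selfadjoint D B" "x \<in> D" "y \<in> D"
  shows "inner (B x) y = inner x (B y)"
proof -
  have "(y, B y) \<in> adjoint_graph D B"
    using assms by (auto simp: positive_selfadjoint_def selfadjoint_on_def)
  then show ?thesis using assms by (auto simp: adjoint_graph_def)
qed

lemma positive_selfadjoint_nonneg:
  "positive_selfadjoint D B \<Longrightarrow> x \<in> D \<Longrightarrow> 0 \<le> inner (B x) x"
  by (simp add: positive_selfadjoint_def)

section \<open>Energy estimate by testing with averages\<close>

lemma mid_in_domain:
  assumes "positive_selfadjoint D B" "\<And>n. e n \<in> D"
  shows "mid e n \<in> D" "B (mid e n) = mid (\<lambda>j. B (e j)) n"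
  unfolding mid_def
  using positive_selfadjoint_scale[OF assms(1)] positive_selfadjoint_add[OF assms(1)] assms(2)
  by (auto simp: scaleR_add_right)

text \<open>Because \<phi> 0 = 0, the starting term drops out and the quadrature at n - 1 is the
  quadrature at n of the shifted sequence. Averaging thus commutes with the discrete convolution,
  and testing with averages produces a genuine quadratic form.\<close>

lemma mid_quadr_eq:
  fixes \<phi> :: "nat \<Rightarrow> 'a::real_vector"
  assumes "\<phi> 0 = 0" "n \<ge> 1"
  shows "mid (quadr k \<beta> \<phi>) n = (\<Sum>l=1..n. weight k \<beta> (n - l) *\<^sub>R mid \<phi> l)"
proof -
  obtain m where n: "n = Suc m" using assms(2) by (cases n) auto
  have q: "quadr k \<beta> \<phi> i = (\<Sum>l=1..i. weight k \<beta> (i - l) *\<^sub>R \<phi> l)" for i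
    using assms(1) by (simp add: quadr_def)
  have "(\<Sum>l=1..Suc m. weight k \<beta> (Suc m - l) *\<^sub>R \<phi> (l - 1))
      = (\<Sum>l=0..m. weight k \<beta> (m - l) *\<^sub>R \<phi> l)"
    unfolding One_nat_def sum.atLeast_Suc_atMost_Suc_shift by simp
  also have "\<dots> = quadr k \<beta> \<phi> m"
    unfolding q by (subst sum.atLeast_Suc_atMost) (simp_all add: assms(1))
  finally have "quadr k \<beta> \<phi> m = (\<Sum>l=1..n. weight k \<beta> (n - l) *\<^sub>R \<phi> (l - 1))"
    by (simp add: n)
  moreover have "quadr k \<beta> \<phi> (n - 1) = quadr k \<beta> \<phi> m" by (simp add: n)
  ultimately have "mid (quadr k \<beta> \<phi>) n = (1 / 2) *\<^sub>R ((\<Sum>l=1..n. weight k \<beta> (n - l) *\<^sub>R \<phi> l)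
      + (\<Sum>l=1..n. weight k \<beta> (n - l) *\<^sub>R \<phi> (l - 1)))"
    unfolding mid_def q[of n] by simp
  also have "\<dots> = (\<Sum>l=1..n. weight k \<beta> (n - l) *\<^sub>R mid \<phi> l)"
    by (simp add: mid_def sum.distrib[symmetric] scaleR_sum_right scaleR_add_right)
  finally show ?thesis .
qed

text \<open>After \<open>mid_quadr_eq\<close> the sum is a causal convolution paired with
  \<open>G l n\<close>, the Gram matrix of the averages for the semi-inner product given by B.
  Symmetry and positivity of B make G symmetric and positive semidefinite.\<close>

lemma quadrature_energy_nonneg:
  fixes e :: "nat \<Rightarrow> 'a::real_inner"
  assumes B: "positive_selfadjoint D B" and e: "\<And>n. e n \<in> D" "e 0 = 0"
    and w: "\<And>a. 0 \<le> (\<Sum>n=1..N. \<Sum>l=1..n. weight k \<beta> (n - l) * a l * a n)"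
  shows "0 \<le> (\<Sum>n=1..N. inner (mid (quadr k \<beta> (\<lambda>j. B (e j))) n) (mid e n))"
proof -
  define G where "G = (\<lambda>l n. inner (B (mid e l)) (mid e n))"
  note midD = mid_in_domain[of D B e, OF B e(1)]
  have "inner (mid (quadr k \<beta> (\<lambda>j. B (e j))) n) (mid e n) = (\<Sum>l=1..n. weight k \<beta> (n - l) * G l n)"
    if "n \<in> {1..N}" for n
    using that e(2) positive_selfadjoint_zero[OF B]
    by (simp add: mid_quadr_eq inner_sum_left G_def midD(2))
  then have "(\<Sum>n=1..N. inner (mid (quadr k \<beta> (\<lambda>j. B (e j))) n) (mid e n))
      = (\<Sum>n=1..N. \<Sum>l=1..n. weight k \<beta> (n - l) * G l n)" by simp
  also have "0 \<le> \<dots>"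
  proof (rule convolution_psd_nonneg)
    show "G i j = G j i" for i j
      unfolding G_def positive_selfadjoint_symmetric[OF B midD(1)[of i] midD(1)[of j]]
      by (rule inner_commute)
    fix x
    define v where "v = (\<lambda>i. x i *\<^sub>R mid e i)"
    have v: "v i \<in> D" "B (v i) = x i *\<^sub>R B (mid e i)" for i
      using positive_selfadjoint_scale[OF B midD(1)] by (auto simp: v_def)
    have "0 \<le> inner (B (\<Sum>i=1..N. v i)) (\<Sum>i=1..N. v i)"
      using positive_selfadjoint_sum[OF B, of "{1..N}" v] v(1)
      by (intro positive_selfadjoint_nonneg[OF B]) auto
    also have "\<dots> = (\<Sum>i=1..N. \<Sum>j=1..N. inner (B (v i)) (v j))"
      using positive_selfadjoint_sum[OF B, of "{1..N}" v] v(1)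
      by (simp add: inner_sum_left inner_sum_right) (rule sum.swap)
    also have "\<dots> = (\<Sum>i=1..N. \<Sum>j=1..N. G i j * x i * x j)"
      unfolding v(2) by (intro sum.cong refl) (simp add: v_def G_def)
    finally show "0 \<le> (\<Sum>i=1..N. \<Sum>j=1..N. G i j * x i * x j)" .
  qed (rule w)
  finally show ?thesis .
qed

text \<open>The inner product of x - y with x + y is the difference of the squared norms, so the sum
  telescopes.\<close>

lemma norm_sq_eq_sum_diffq_mid:
  fixes e :: "nat \<Rightarrow> 'a::real_inner"
  assumes "k > 0" "e 0 = 0"
  shows "(norm (e m))\<^sup>2 = 2 * k * (\<Sum>n=1..m. inner (diffq k e n) (mid e n))"
proof (induction m)
  case 0
  then show ?case using assms by simp
next
  case (Suc m)
  have "2 * k * inner (diffq k e (Suc m)) (mid e (Suc m)) = (norm (e (Suc m)))\<^sup>2 - (norm (e m))\<^sup>2"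
    using assms(1) by (simp add: diffq_def mid_def power2_norm_eq_inner inner_diff_left inner_add_right
        inner_commute algebra_simps)
  with Suc show ?case by (simp add: distrib_left)
qed

lemma crank_nicolson_stability:
  fixes e :: "nat \<Rightarrow> 'a::real_inner"
  assumes k: "k > 0" and e: "\<And>q n. q \<in> Q \<Longrightarrow> e n \<in> D q" "e 0 = 0"
    and B: "\<And>q. q \<in> Q \<Longrightarrow> positive_selfadjoint (D q) (B q)"
    and w: "\<And>q N a. q \<in> Q \<Longrightarrow> 0 \<le> (\<Sum>n=1..N. \<Sum>l=1..n. weight k (\<beta> q) (n - l) * a l * a n)"
    and eq: "\<And>n. n \<ge> 1 \<Longrightarrow> diffq k e n + (\<Sum>q\<in>Q. mid (quadr k (\<beta> q) (\<lambda>j. B q (e j))) n) = \<tau> n"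
  shows "norm (e N) \<le> 2 * k * (\<Sum>n=1..N. norm (\<tau> n))"
proof -
  have energy: "(norm (e m))\<^sup>2 \<le> 2 * k * (\<Sum>n=1..m. norm (\<tau> n) * norm (mid e n))" for m
  proof -
    define E where "E = (\<lambda>q n. inner (mid (quadr k (\<beta> q) (\<lambda>j. B q (e j))) n) (mid e n))"
    have "inner (diffq k e n) (mid e n) + (\<Sum>q\<in>Q. E q n) \<le> norm (\<tau> n) * norm (mid e n)" if "n \<ge> 1" for n
      using norm_cauchy_schwarz[of "\<tau> n" "mid e n"]
      unfolding eq[OF that, symmetric] E_def by (simp add: inner_add_left inner_sum_left)
    then have "(\<Sum>n=1..m. inner (diffq k e n) (mid e n) + (\<Sum>q\<in>Q. E q n))
        \<le> (\<Sum>n=1..m. norm (\<tau> n) * norm (mid e n))" by (intro sum_mono) auto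
    moreover have "0 \<le> (\<Sum>n=1..m. \<Sum>q\<in>Q. E q n)"
    proof (subst sum.swap, rule sum_nonneg)
      fix q assume q: "q \<in> Q"
      show "0 \<le> (\<Sum>n=1..m. E q n)"
        unfolding E_def
      proof (rule quadrature_energy_nonneg)
        show "positive_selfadjoint (D q) (B q)" "\<And>n. e n \<in> D q" "e 0 = 0" by (fact B[OF q] e(1)[OF q] e(2))+
      qed (rule w[OF q])
    qed
    ultimately have "(\<Sum>n=1..m. inner (diffq k e n) (mid e n)) \<le> (\<Sum>n=1..m. norm (\<tau> n) * norm (mid e n))"
      by (simp add: sum.distrib)
    then show ?thesis using k norm_sq_eq_sum_diffq_mid[of k e m, OF k e(2)] by simp
  qed
  \<comment> \<open>The energy bound is quadratic on the left. Evaluating it at an index m \<le> N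
    where the largest norm M is attained and bounding all averages by M allows one factor M to be
    cancelled.\<close>
  define M where "M = Max ((\<lambda>n. norm (e n)) ` {..N})"
  have M: "norm (e n) \<le> M" if "n \<le> N" for n using that by (simp add: M_def)
  have "M \<in> (\<lambda>n. norm (e n)) ` {..N}" unfolding M_def by (rule Max_in) auto
  then obtain m where m: "m \<le> N" "norm (e m) = M" by auto
  have M0: "M \<ge> 0" using m(2) norm_ge_zero[of "e m"] by simp
  have mid: "norm (mid e n) \<le> M" if "n \<le> N" for n
    using norm_triangle_ineq[of "e n" "e (n - 1)"] M[OF that] M[OF le_trans[OF diff_le_self that, of 1]]
    by (simp add: mid_def)
  have "M\<^sup>2 \<le> 2 * k * (\<Sum>n=1..m. norm (\<tau> n) * norm (mid e n))" using energy[of m] m(2) by simp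
  also have "\<dots> \<le> 2 * k * (\<Sum>n=1..m. norm (\<tau> n) * M)"
    using k m(1) by (intro mult_left_mono sum_mono mid) auto
  also have "\<dots> \<le> 2 * k * (\<Sum>n=1..N. norm (\<tau> n) * M)"
    using k m(1) M0 by (intro mult_left_mono sum_mono2) auto
  also have "\<dots> = 2 * k * (\<Sum>n=1..N. norm (\<tau> n)) * M" by (simp add: sum_distrib_right)
  finally have *: "M * M \<le> (2 * k * (\<Sum>n=1..N. norm (\<tau> n))) * M" by (simp add: power2_eq_square)
  have "M \<le> 2 * k * (\<Sum>n=1..N. norm (\<tau> n))"
  proof (cases "M = 0")
    case True
    then show ?thesis using k by (simp add: sum_nonneg)
  next
    case False
    then show ?thesis using * M0 by simp
  qed
  then show ?thesis using M[of N] by simp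
qed

text \<open>After interchanging the sums, each y n is multiplied by a geometric tail of size at most
  \<open>r ^ n / (1 - r)\<close>. In the exact summation by parts the boundary term
  \<open>- r ^ Suc p * S p\<close> has the favourable sign.\<close>

lemma sum_geometric_partial_sums_le:
  fixes x y :: "nat \<Rightarrow> real"
  assumes r: "0 \<le> r" "r < 1" and x: "\<And>N. x N \<le> A * (\<Sum>n=1..N. y n)" and "A \<ge> 0" "\<And>n. y n \<ge> 0"
  shows "(\<Sum>N\<le>p. r ^ N * x N) \<le> A / (1 - r) * (\<Sum>n=1..p. r ^ n * y n)"
proof -
  define S where "S = (\<lambda>N. \<Sum>n=1..N. y n)"
  have S0: "S N \<ge> 0" for N using assms(5) by (simp add: S_def sum_nonneg)
  have "(1 - r) * (\<Sum>N\<le>p. r ^ N * S N) = (\<Sum>n=1..p. r ^ n * y n) - r ^ Suc p * S p"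
  proof (induction p)
    case 0
    then show ?case by (simp add: S_def)
  next
    case (Suc p)
    have S: "S (Suc p) = S p + y (Suc p)" by (simp add: S_def)
    have "(1 - r) * (\<Sum>N\<le>Suc p. r ^ N * S N)
        = (1 - r) * (\<Sum>N\<le>p. r ^ N * S N) + (1 - r) * (r ^ Suc p * S (Suc p))"
      by (simp only: sum.atMost_Suc distrib_left)
    also have "\<dots> = (\<Sum>n=1..p. r ^ n * y n) - r ^ Suc p * S p + (1 - r) * (r ^ Suc p * S (Suc p))"
      by (simp only: Suc)
    also have "\<dots> = (\<Sum>n=1..Suc p. r ^ n * y n) - r ^ Suc (Suc p) * S (Suc p)"
      unfolding S by (simp add: algebra_simps)
    finally show ?case .
  qed
  also have "\<dots> \<le> (\<Sum>n=1..p. r ^ n * y n)" using r S0[of p] by simp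
  finally have "(\<Sum>N\<le>p. r ^ N * S N) \<le> (\<Sum>n=1..p. r ^ n * y n) / (1 - r)"
    using r by (simp add: pos_le_divide_eq mult.commute)
  from mult_left_mono[OF this \<open>A \<ge> 0\<close>]
  have "A * (\<Sum>N\<le>p. r ^ N * S N) \<le> A / (1 - r) * (\<Sum>n=1..p. r ^ n * y n)" by simp
  moreover have "(\<Sum>N\<le>p. r ^ N * x N) \<le> A * (\<Sum>N\<le>p. r ^ N * S N)"
    unfolding sum_distrib_left
  proof (rule sum_mono)
    fix N
    have "r ^ N * x N \<le> r ^ N * (A * S N)" using r x[of N] by (intro mult_left_mono) (auto simp: S_def)
    then show "r ^ N * x N \<le> A * (r ^ N * S N)" by (simp add: mult_ac)
  qed
  ultimately show ?thesis by linarith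
qed

text \<open>The l2 norm is at most the l1 norm, for the sequence
  \<open>exp (- (c / 2) * real n) * norm (v n)\<close>; halving the exponent is the source of c/2 in
  the estimate. If the l1 sum is finite, \<open>a n * a n \<le> suminf a * a n\<close> also gives
  the summability demanded by \<open>A_norm\<close>.\<close>

lemma A_norm_le_suminf:
  "A_norm c v \<le> (\<Sum>n. ennreal (exp (- (c / 2) * real n) * norm (v n)))"
proof (cases "(\<Sum>n. ennreal (exp (- (c / 2) * real n) * norm (v n))) = \<infinity>")
  case True
  then show ?thesis by simp
next
  case False
  define a where "a = (\<lambda>n. exp (- (c / 2) * real n) * norm (v n))"
  have a0: "a n \<ge> 0" for n by (simp add: a_def)
  have sm: "summable a"
  proof (rule summable_suminf_not_top)
    show "(\<Sum>n. ennreal (a n)) \<noteq> top" using False by (simp add: a_def)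
  qed (rule a0)
  have eq: "exp (- c * real n) * (norm (v n))\<^sup>2 = a n * a n" for n
  proof -
    have "exp (- c * real n) = exp (- (c / 2) * real n) * exp (- (c / 2) * real n)"
      unfolding mult_exp_exp by simp
    then show ?thesis by (simp only: a_def power2_eq_square mult_ac)
  qed
  have le: "a n * a n \<le> suminf a * a n" for n
    using a0 sum_le_suminf[OF sm, of "{n}"] by (intro mult_right_mono) auto
  have sm2: "summable (\<lambda>n. a n * a n)"
  proof (rule summable_comparison_test'[OF summable_mult[OF sm, of "suminf a"]])
    show "norm (a n * a n) \<le> suminf a * a n" for n using le[of n] a0[of n] by simp
  qed
  have "(\<Sum>n. a n * a n) \<le> (\<Sum>n. suminf a * a n)"
    by (intro suminf_le le sm2 summable_mult sm)
  also have "\<dots> = (suminf a)\<^sup>2" using sm by (simp add: suminf_mult power2_eq_square)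
  finally have "sqrt (\<Sum>n. a n * a n) \<le> suminf a"
    using suminf_nonneg[OF sm a0] by (simp add: real_le_lsqrt suminf_nonneg sm2 a0)
  moreover have "A_norm c v = ennreal (sqrt (\<Sum>n. a n * a n))"
    unfolding A_norm_def eq using sm2 by simp
  moreover have "(\<Sum>n. ennreal (a n)) = ennreal (suminf a)"
    by (rule suminf_ennreal2[OF a0 sm])
  ultimately show ?thesis by (simp add: ennreal_leI a_def)
qed

lemma A_norm_le_of_stability:
  fixes e \<tau> :: "nat \<Rightarrow> 'a::real_inner"
  assumes c: "c > 0" and k: "k > 0" and e: "\<And>N. norm (e N) \<le> 2 * k * (\<Sum>n=1..N. norm (\<tau> n))"
  shows "A_norm c e \<le> ennreal (2 * k / (1 - exp (- (c / 2)))) *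
    (\<Sum>\<^sub>\<infinity>n\<in>{1..}. ennreal (exp (- (c / 2) * real n)) * ennreal (norm (\<tau> n)))"
proof -
  define r where "r = exp (- (c / 2))"
  have r: "0 \<le> r" "r < 1" using c by (auto simp: r_def)
  have rn: "exp (- (c / 2) * real n) = r ^ n" for n
    by (simp add: r_def exp_of_nat_mult[symmetric] mult.commute)
  define g where "g = (\<lambda>n. ennreal (r ^ n) * ennreal (norm (\<tau> n)))"
  have K: "2 * k / (1 - r) \<ge> 0" using k r by simp
  have "A_norm c e \<le> (\<Sum>N. ennreal (r ^ N * norm (e N)))"
    using A_norm_le_suminf[of c e] by (simp only: rn)
  \<comment> \<open>The comparison is made for partial sums, which are finite reals; only the limit
    is taken in the extended reals, where the right-hand side may be infinite.\<close>
  also have "\<dots> \<le> ennreal (2 * k / (1 - r)) * (\<Sum>\<^sub>\<infinity>n\<in>{1..}. g n)"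
  proof (rule suminf_le_const)
    fix p
    have "(\<Sum>N<p. ennreal (r ^ N * norm (e N))) \<le> (\<Sum>N\<le>p. ennreal (r ^ N * norm (e N)))"
      by (rule sum_mono2) auto
    also have "\<dots> = ennreal (\<Sum>N\<le>p. r ^ N * norm (e N))" using r by (simp add: sum_ennreal)
    also have "\<dots> \<le> ennreal (2 * k / (1 - r) * (\<Sum>n=1..p. r ^ n * norm (\<tau> n)))"
      using k by (intro ennreal_leI sum_geometric_partial_sums_le[OF r e]) auto
    also have "\<dots> = ennreal (2 * k / (1 - r)) * ennreal (\<Sum>n=1..p. r ^ n * norm (\<tau> n))"
      using K r by (intro ennreal_mult) (auto intro!: sum_nonneg)
    also have "ennreal (\<Sum>n=1..p. r ^ n * norm (\<tau> n)) = (\<Sum>n=1..p. g n)"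
      using r by (simp add: g_def ennreal_mult'[symmetric])
    also have "\<dots> = (\<Sum>\<^sub>\<infinity>n\<in>{1..p}. g n)" by simp
    also have "\<dots> \<le> (\<Sum>\<^sub>\<infinity>n\<in>{1..}. g n)"
      by (rule infsum_mono_neutral) (auto intro!: nonneg_summable_on_complete)
    finally show "(\<Sum>N<p. ennreal (r ^ N * norm (e N))) \<le> ennreal (2 * k / (1 - r)) * (\<Sum>\<^sub>\<infinity>n\<in>{1..}. g n)"
      by (simp add: mult_left_mono)
  qed auto
  finally show ?thesis unfolding g_def rn r_def[symmetric] .
qed

section \<open>Vector-valued calculus\<close>

text \<open>The inequality is closed in y, hence extends from D to y = x. Values of an unbounded
  operator can so be estimated by testing with its domain only, where symmetry moves the operator
  onto the test vector.\<close>

lemma norm_le_of_dense_inner: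
  fixes x :: "'a::real_inner"
  assumes D: "closure D = UNIV" and M: "0 \<le> M" and le: "\<And>y. y \<in> D \<Longrightarrow> inner y x \<le> M * norm y"
  shows "norm x \<le> M"
proof -
  have "closed {y. inner y x \<le> M * norm y}"
    by (intro closed_Collect_le continuous_intros)
  then have "closure D \<subseteq> {y. inner y x \<le> M * norm y}"
    by (intro closure_minimal) (use le in auto)
  then have "inner x x \<le> M * norm x" using D by auto
  then have "norm x * norm x \<le> M * norm x" by (simp add: power2_norm_eq_inner[symmetric] power2_eq_square)
  then show ?thesis using M by (cases "x = 0") auto
qed

lemma norm_increment_le:
  fixes g :: "real \<Rightarrow> 'a::real_inner"
  assumes "a \<le> b" "continuous_on {a..b} g"
    and "\<And>t. a < t \<Longrightarrow> t < b \<Longrightarrow> (g has_vector_derivative g' t) (at t)"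
    and "\<And>t. a < t \<Longrightarrow> t < b \<Longrightarrow> norm (g' t) \<le> M"
  shows "norm (g b - g a) \<le> M * (b - a)"
proof (cases "a = b")
  case False
  then have ab: "a < b" using assms(1) by simp
  from mvt_general[OF ab assms(2), of "\<lambda>t h. h *\<^sub>R g' t"] assms(3)
  obtain t where t: "t \<in> {a<..<b}" "norm (g b - g a) \<le> norm ((b - a) *\<^sub>R g' t)"
    unfolding has_vector_derivative_def by blast
  have "norm ((b - a) *\<^sub>R g' t) \<le> (b - a) * M"
    using ab assms(4) t(1) by (simp add: mult_left_mono)
  then show ?thesis using t(2) by (simp add: mult.commute)
qed simp

lemma norm_linearization_le:
  fixes g :: "real \<Rightarrow> 'a::real_inner"
  assumes "a \<le> b" "continuous_on {a..b} g"
    and "\<And>t. a < t \<Longrightarrow> t < b \<Longrightarrow> (g has_vector_derivative g' t) (at t)"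
    and "\<And>t. a < t \<Longrightarrow> t < b \<Longrightarrow> norm (g' t - p) \<le> M"
  shows "norm (g b - g a - (b - a) *\<^sub>R p) \<le> M * (b - a)"
proof -
  have "norm ((g b - b *\<^sub>R p) - (g a - a *\<^sub>R p)) \<le> M * (b - a)"
  proof (rule norm_increment_le[where g' = "\<lambda>t. g' t - p" and g = "\<lambda>t. g t - t *\<^sub>R p"])
    show "((\<lambda>t. g t - t *\<^sub>R p) has_vector_derivative g' t - p) (at t)" if "a < t" "t < b" for t
      using assms(3)[OF that] by (auto intro!: derivative_eq_intros)
  qed (use assms in \<open>auto intro!: continuous_intros\<close>)
  then show ?thesis by (simp add: algebra_simps)
qed

text \<open>Replacing w by the constant \<open>w b\<close> costs (b - a) M, and replacing that
  constant by the average of the end values costs half as much again; together 3/2. The derivative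
  is taken only in the open interval so that a = 0 is allowed, where u is merely continuous.\<close>

lemma trapezoid_error_first_order:
  fixes v w :: "real \<Rightarrow> 'a::real_inner"
  assumes "a \<le> b" "continuous_on {a..b} v"
    and "\<And>t. a < t \<Longrightarrow> t < b \<Longrightarrow> (v has_vector_derivative w t) (at t)"
    and M: "\<And>t. a \<le> t \<Longrightarrow> t < b \<Longrightarrow> norm (w t - w b) \<le> M"
  shows "norm (v b - v a - ((b - a) / 2) *\<^sub>R (w a + w b)) \<le> 3 / 2 * (b - a) * M"
proof (cases "a = b")
  case False
  have "norm (v b - v a - (b - a) *\<^sub>R w b) \<le> M * (b - a)"
    using assms by (intro norm_linearization_le) auto
  moreover have "norm (((b - a) / 2) *\<^sub>R (w a - w b)) \<le> (b - a) / 2 * M"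
    using assms False M[of a] by (simp add: divide_right_mono mult_left_mono)
  moreover have "v b - v a - ((b - a) / 2) *\<^sub>R (w a + w b)
      = (v b - v a - (b - a) *\<^sub>R w b) - ((b - a) / 2) *\<^sub>R (w a - w b)"
  proof -
    have "(b - a) *\<^sub>R w b = ((b - a) / 2) *\<^sub>R w b + ((b - a) / 2) *\<^sub>R w b"
      by (simp add: scaleR_add_left[symmetric])
    then show ?thesis by (simp add: scaleR_add_right scaleR_diff_right)
  qed
  ultimately show ?thesis
    using norm_triangle_ineq4[of "v b - v a - (b - a) *\<^sub>R w b" "((b - a) / 2) *\<^sub>R (w a - w b)"]
    by (simp add: field_simps)
qed simp

text \<open>The trapezoidal rule is exact for quadratic polynomials, so the second-order Taylor polynomial
  at \<open>b\<close> may be subtracted before the first-order estimate is applied.\<close>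

lemma trapezoid_error_second_order:
  fixes v w z :: "real \<Rightarrow> 'a::real_inner"
  assumes ab: "a \<le> b"
    and v: "\<And>t. a \<le> t \<Longrightarrow> t \<le> b \<Longrightarrow> (v has_vector_derivative w t) (at t)"
    and w: "\<And>t. a \<le> t \<Longrightarrow> t \<le> b \<Longrightarrow> (w has_vector_derivative z t) (at t)"
    and M: "\<And>t. a \<le> t \<Longrightarrow> t \<le> b \<Longrightarrow> norm (z t - z b) \<le> M"
  shows "norm (v b - v a - ((b - a) / 2) *\<^sub>R (w a + w b)) \<le> 3 / 2 * (b - a)\<^sup>2 * M"
proof -
  define V where "V = (\<lambda>t. v t - ((t - b)\<^sup>2 / 2) *\<^sub>R z b)"
  define W where "W = (\<lambda>t. w t - (t - b) *\<^sub>R z b)"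
  have dV: "(V has_vector_derivative W t) (at t)" if "a \<le> t" "t \<le> b" for t
    unfolding V_def W_def by (rule derivative_eq_intros v[OF that] refl | simp)+
  have cw: "continuous_on {a..b} w"
    by (rule continuous_on_vector_derivative)
      (use w in \<open>auto intro: has_vector_derivative_at_within\<close>)
  have cV: "continuous_on {a..b} V"
    by (rule continuous_on_vector_derivative)
      (use dV in \<open>auto intro: has_vector_derivative_at_within\<close>)
  have M0: "0 \<le> M" using M[OF ab order_refl] by simp
  have "norm (W t - W b) \<le> (b - a) * M" if t: "a \<le> t" "t < b" for t
  proof -
    have "norm (w b - w t - (b - t) *\<^sub>R z b) \<le> M * (b - t)"
      using t by (intro norm_linearization_le[where g' = z] continuous_on_subset[OF cw] w M) auto
    also have "\<dots> \<le> M * (b - a)" using t M0 by (intro mult_left_mono) auto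
    also have "norm (w b - w t - (b - t) *\<^sub>R z b) = norm (W t - W b)"
      by (subst norm_minus_commute) (simp add: W_def algebra_simps)
    finally show ?thesis by (simp add: mult.commute)
  qed
  then have "norm (V b - V a - ((b - a) / 2) *\<^sub>R (W a + W b)) \<le> 3 / 2 * (b - a) * ((b - a) * M)"
    by (intro trapezoid_error_first_order ab cV dV) auto
  moreover have "V b - V a - ((b - a) / 2) *\<^sub>R (W a + W b) = v b - v a - ((b - a) / 2) *\<^sub>R (w a + w b)"
  proof -
    have "V b - V a = (v b - v a) + ((b - a)\<^sup>2 / 2) *\<^sub>R z b"
      by (simp add: V_def power2_commute[of a b])
    moreover have "W a + W b = (w a + w b) + (b - a) *\<^sub>R z b"
      by (simp add: W_def algebra_simps)
    ultimately show ?thesis by (simp add: scaleR_add_right power2_eq_square)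
  qed
  ultimately show ?thesis by (simp add: power2_eq_square mult_ac)
qed

definition interp_error :: "(real \<Rightarrow> 'a::real_vector) \<Rightarrow> real \<Rightarrow> real \<Rightarrow> real \<Rightarrow> 'a" where
  "interp_error \<phi> a b s = \<phi> s - \<phi> a - ((s - a) / (b - a)) *\<^sub>R (\<phi> b - \<phi> a)"

lemma interp_error_le:
  fixes \<phi> :: "real \<Rightarrow> 'a::real_normed_vector"
  assumes "a < b" "s \<in> {a..b}" "norm (\<phi> s - \<phi> a) \<le> M" "norm (\<phi> b - \<phi> a) \<le> M"
  shows "norm (interp_error \<phi> a b s) \<le> 2 * M"
proof -
  have "\<bar>(s - a) / (b - a)\<bar> \<le> 1" using assms(1,2) by auto
  then have "norm (((s - a) / (b - a)) *\<^sub>R (\<phi> b - \<phi> a)) \<le> 1 * norm (\<phi> b - \<phi> a)"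
    unfolding norm_scaleR by (intro mult_right_mono) auto
  then show ?thesis
    using assms(3,4) norm_triangle_ineq4[of "\<phi> s - \<phi> a" "((s - a) / (b - a)) *\<^sub>R (\<phi> b - \<phi> a)"]
    by (simp add: interp_error_def)
qed

text \<open>Affine functions have no interpolation error, so the affine function through
  \<open>\<phi> a\<close> with slope \<open>\<phi>' b\<close> may be subtracted. The remainder R
  varies by at most (b - a) M, and the crude bound \<open>interp_error_le\<close> suffices for
  it.\<close>

lemma interp_error_second_order:
  fixes \<phi> :: "real \<Rightarrow> 'a::real_inner"
  assumes ab: "a < b" and s: "s \<in> {a..b}"
    and d: "\<And>t. a \<le> t \<Longrightarrow> t \<le> b \<Longrightarrow> (\<phi> has_vector_derivative \<phi>' t) (at t)"
    and M: "\<And>t. a \<le> t \<Longrightarrow> t \<le> b \<Longrightarrow> norm (\<phi>' t - \<phi>' b) \<le> M"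
  shows "norm (interp_error \<phi> a b s) \<le> 2 * (b - a) * M"
proof -
  define R where "R = (\<lambda>t. \<phi> t - \<phi> a - (t - a) *\<^sub>R \<phi>' b)"
  have c: "continuous_on {a..b} \<phi>"
    by (rule continuous_on_vector_derivative)
      (use d in \<open>auto intro: has_vector_derivative_at_within\<close>)
  have M0: "0 \<le> M" using M[of b] ab by simp
  have R: "norm (R t - R a) \<le> (b - a) * M" if t: "t \<in> {a..b}" for t
  proof -
    have "norm (R t) \<le> M * (t - a)" unfolding R_def
      using t by (intro norm_linearization_le[where g' = \<phi>'] continuous_on_subset[OF c] d M) auto
    also have "\<dots> \<le> M * (b - a)" using t M0 by (intro mult_left_mono) auto
    finally show ?thesis by (simp add: R_def mult.commute)
  qed
  have "norm (interp_error R a b s) \<le> 2 * ((b - a) * M)"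
    using ab by (intro interp_error_le s R) auto
  moreover have "interp_error R a b s = interp_error \<phi> a b s"
    using ab by (simp add: interp_error_def R_def scaleR_diff_right)
  ultimately show ?thesis by (simp add: mult_ac)
qed

text \<open>By the scalar fundamental theorem, the difference between an increment of g and the
  integral of g' has zero inner product with every y in the dense set D, hence vanishes. So g is a
  primitive of a continuous function and differentiable in norm.\<close>

lemma weak_derivative_imp_has_vector_derivative:
  fixes g :: "real \<Rightarrow> 'a::{real_inner,banach}"
  assumes D: "closure D = UNIV" and c: "continuous_on {0<..} g'"
    and d: "\<And>t y. t > 0 \<Longrightarrow> y \<in> D \<Longrightarrow> ((\<lambda>s. inner y (g s)) has_real_derivative inner y (g' t)) (at t)"
    and t: "t > 0"
  shows "(g has_vector_derivative g' t) (at t)"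
proof -
  define a b where "a = t / 2" and "b = 2 * t"
  have ab: "0 < a" "a < t" "t < b" using t by (auto simp: a_def b_def)
  have c': "continuous_on {a..s} g'" for s
    by (rule continuous_on_subset[OF c]) (use ab in auto)
  have eq: "g a + integral {a..s} g' = g s" if s: "s \<in> {a..b}" for s
  proof -
    have "norm (g s - g a - integral {a..s} g') \<le> 0"
    proof (rule norm_le_of_dense_inner[OF D])
      fix y assume y: "y \<in> D"
      have "((\<lambda>r. inner y (g' r)) has_integral inner y (g s) - inner y (g a)) {a..s}"
      proof (rule fundamental_theorem_of_calculus)
        show "((\<lambda>r. inner y (g r)) has_vector_derivative inner y (g' r)) (at r within {a..s})"
          if "r \<in> {a..s}" for r
          unfolding has_real_derivative_iff_has_vector_derivative[symmetric]
          by (rule has_field_derivative_at_within[OF d]) (use that ab y in auto)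
      qed (use s in auto)
      moreover have "((\<lambda>r. inner y (g' r)) has_integral inner y (integral {a..s} g')) {a..s}"
        using has_integral_linear[OF integrable_integral[OF integrable_continuous_interval[OF c']]
            bounded_linear_inner_right[of y]] by (simp add: comp_def)
      ultimately have "inner y (g s) - inner y (g a) = inner y (integral {a..s} g')"
        by (rule has_integral_unique)
      then show "inner y (g s - g a - integral {a..s} g') \<le> 0 * norm y"
        by (simp add: inner_diff_right)
    qed simp
    then show ?thesis by (simp add: algebra_simps)
  qed
  have "((\<lambda>s. g a + integral {a..s} g') has_vector_derivative 0 + g' t) (at t within {a..b})"
    using ab by (intro has_vector_derivative_add has_vector_derivative_const
        integral_has_vector_derivative c') auto
  from this[unfolded add_0_left] have "(g has_vector_derivative g' t) (at t within {a..b})"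
    by (rule has_vector_derivative_transform_within[where d = 1]) (use ab eq in auto)
  moreover have "at t within {a..b} = at t" using ab by (intro at_within_interior) auto
  ultimately show ?thesis by simp
qed

text \<open>Passes from Henstock-Kurzweil integrals to the nonnegative Lebesgue integrals of the
  estimate. The set S may exceed {a..b}, so that increments on intervals away from 0 are bounded by
  an integral starting at 0.\<close>

lemma norm_increment_le_nn_integral:
  fixes g :: "real \<Rightarrow> 'a::banach"
  assumes ab: "a \<le> b" "{a..b} \<subseteq> S"
    and d: "\<And>t. a \<le> t \<Longrightarrow> t \<le> b \<Longrightarrow> (g has_vector_derivative g' t) (at t)"
    and c: "continuous_on {a..b} g'"
  shows "ennreal (norm (g b - g a)) \<le> (\<integral>\<^sup>+\<zeta>\<in>S. ennreal (norm (g' \<zeta>)) \<partial>lebesgue)"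
proof -
  have "(g' has_integral g b - g a) {a..b}"
    by (rule fundamental_theorem_of_calculus[OF ab(1)])
      (use d in \<open>auto intro: has_vector_derivative_at_within\<close>)
  then have "g b - g a = integral {a..b} g'" by (simp add: integral_unique)
  also have "norm \<dots> \<le> integral {a..b} (\<lambda>t. norm (g' t))"
    by (intro integral_norm_bound_integral integrable_continuous_interval continuous_intros c) auto
  finally have "ennreal (norm (g b - g a)) \<le> ennreal (integral {a..b} (\<lambda>t. norm (g' t)))"
    by (rule ennreal_leI)
  also have "\<dots> = (\<integral>\<^sup>+\<zeta>\<in>{a..b}. ennreal (norm (g' \<zeta>)) \<partial>lborel)"
    by (rule nn_integral_has_integral_lebesgue'[symmetric])
      (auto intro!: integrable_integral integrable_continuous_interval continuous_intros c)
  also have "\<dots> = (\<integral>\<^sup>+\<zeta>\<in>{a..b}. ennreal (norm (g' \<zeta>)) \<partial>lebesgue)"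
    by (rule nn_integral_completion[symmetric])
  also have "\<dots> \<le> (\<integral>\<^sup>+\<zeta>\<in>S. ennreal (norm (g' \<zeta>)) \<partial>lebesgue)"
    by (intro nn_integral_mono mult_left_mono) (use ab(2) in \<open>auto simp: indicator_def\<close>)
  finally show ?thesis .
qed

lemma nn_integral_norm_finite:
  fixes g' :: "real \<Rightarrow> 'a::banach"
  assumes c: "continuous_on {a..b} g'"
  shows "(\<integral>\<^sup>+\<zeta>\<in>{a..b}. ennreal (norm (g' \<zeta>)) \<partial>lebesgue) < \<infinity>"
proof -
  have "(\<integral>\<^sup>+\<zeta>\<in>{a..b}. ennreal (norm (g' \<zeta>)) \<partial>lborel) = ennreal (integral {a..b} (\<lambda>t. norm (g' t)))"
    by (rule nn_integral_has_integral_lebesgue')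
      (auto intro!: integrable_integral integrable_continuous_interval continuous_intros c)
  then show ?thesis by (simp add: nn_integral_completion)
qed

section \<open>Error of the interpolation quadrature\<close>

lemma norm_convolution_le:
  fixes \<Psi> :: "real \<Rightarrow> 'a::banach"
  assumes \<beta>: "\<beta> absolutely_integrable_on {0..t}"
    and int: "(\<lambda>s. \<beta> (t - s) *\<^sub>R \<Psi> s) integrable_on {0..t}"
    and M: "\<And>s. s \<in> {0..t} \<Longrightarrow> norm (\<Psi> s) \<le> M"
  shows "norm (integral {0..t} (\<lambda>s. \<beta> (t - s) *\<^sub>R \<Psi> s)) \<le> M * integral {0..t} (\<lambda>s. \<bar>\<beta> s\<bar>)"
proof -
  have "(\<lambda>s. \<bar>\<beta> s\<bar>) integrable_on {0..t}" using \<beta> by (simp add: absolutely_integrable_on_def)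
  then have "((\<lambda>s. \<bar>\<beta> s\<bar>) has_integral integral {0..t} (\<lambda>s. \<bar>\<beta> s\<bar>)) {t - t..t - 0}"
    by (simp add: has_integral_integral)
  from has_integral_mult_left[OF has_integral_diff_substitution[OF this], of M]
  have *: "((\<lambda>s. \<bar>\<beta> (t - s)\<bar> * M) has_integral integral {0..t} (\<lambda>s. \<bar>\<beta> s\<bar>) * M) {0..t}" .
  have "norm (integral {0..t} (\<lambda>s. \<beta> (t - s) *\<^sub>R \<Psi> s)) \<le> integral {0..t} (\<lambda>s. \<bar>\<beta> (t - s)\<bar> * M)"
    using int * by (intro integral_norm_bound_integral) (auto simp: integrable_on_def intro!: mult_left_mono M)
  then show ?thesis unfolding integral_unique[OF *] by (simp only: mult.commute)
qed

lemma continuous_on_hat [continuous_intros]: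
  "continuous_on S g \<Longrightarrow> continuous_on S (\<lambda>x. hat (g x))"
  unfolding hat_def by (intro continuous_intros)

lemma hat_eq_0: "k > 0 \<Longrightarrow> k \<le> \<bar>x\<bar> \<Longrightarrow> hat (x / k) = 0"
  by (simp add: hat_def field_simps)

text \<open>Product integration: the quadrature integrates \<beta> exactly against the piecewise
  linear interpolant. \<open>chi0\<close> belongs to the half hat at 0, and \<open>weight\<close> to
  the hats at later nodes, with the hat at the last node cut in half.\<close>

lemma quadr_has_integral:
  fixes \<phi> :: "nat \<Rightarrow> 'a::banach"
  assumes \<beta>: "\<And>X. \<beta> absolutely_integrable_on {0..X}" and k: "k > 0" and n: "n \<ge> 1"
  shows "((\<lambda>s. \<beta> (real n * k - s) *\<^sub>R (\<Sum>l=0..n. hat ((s - real l * k) / k) *\<^sub>R \<phi> l))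
    has_integral quadr k \<beta> \<phi> n) {0..real n * k}"
proof -
  define t where "t = real n * k"
  have t: "t > 0" "k \<le> t" using k n by (auto simp: t_def)
  define v where "v = (\<lambda>l. if l = 0 then chi0 k \<beta> n else weight k \<beta> (n - l))"
  have v: "((\<lambda>s. \<beta> (t - s) * hat ((s - real l * k) / k)) has_integral v l) {0..t}" if l: "l \<in> {0..n}" for l
  proof -
    have "(\<lambda>x. \<beta> x * hat ((t - x - real l * k) / k)) integrable_on {0..t}"
      by (intro set_lebesgue_integral_eq_integral(1) absolutely_integrable_mult_continuous \<beta> continuous_intros)
        (use k in auto)
    then have "((\<lambda>x. \<beta> x * hat ((t - x - real l * k) / k)) has_integral
        integral {0..t} (\<lambda>x. \<beta> x * hat ((t - x - real l * k) / k))) {t - t..t - 0}"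
      by (simp add: has_integral_integral)
    from has_integral_diff_substitution[OF this]
    have "(\<lambda>s. \<beta> (t - s) * hat ((s - real l * k) / k)) integrable_on {0..t}"
      by (auto simp: integrable_on_def)
    moreover have "integral {0..t} (\<lambda>s. \<beta> (t - s) * hat ((s - real l * k) / k)) = v l"
    proof (cases "l = 0")
      case True
      have "integral {0..t} (\<lambda>s. \<beta> (t - s) * hat (s / k)) = integral {0..k} (\<lambda>s. \<beta> (t - s) * hat (s / k))"
        by (rule integral_zero_outside) (use t k in \<open>auto simp: hat_eq_0\<close>)
      then show ?thesis using True n by (simp add: v_def chi0_def t_def)
    next
      case False
      define d where "d = real (n - l) * k"
      have d: "d = t - real l * k" "d \<ge> 0" using l k by (auto simp: d_def t_def of_nat_diff algebra_simps)
      have lk: "k \<le> real l * k" using False k by simp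
      have "integral {0..t} (\<lambda>s. \<beta> (t - s) * hat ((s - real l * k) / k))
          = integral {0 - real l * k..t - real l * k} (\<lambda>\<zeta>. \<beta> (t - (\<zeta> + real l * k)) * hat ((\<zeta> + real l * k - real l * k) / k))"
        by (rule integral_shift_real_ivl[symmetric])
      also have "\<dots> = integral {- (real l * k)..d} (\<lambda>\<zeta>. \<beta> (d - \<zeta>) * hat (\<zeta> / k))"
        by (simp add: d(1) algebra_simps)
      also have "\<dots> = integral {- k..min k d} (\<lambda>\<zeta>. \<beta> (d - \<zeta>) * hat (\<zeta> / k))"
        by (rule integral_zero_outside) (use lk k in \<open>auto simp: hat_eq_0\<close>)
      finally show ?thesis using False by (simp add: v_def weight_def d_def)
    qed
    ultimately show ?thesis by (simp add: has_integral_integral)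
  qed
  have "((\<lambda>s. \<Sum>l=0..n. (\<beta> (t - s) * hat ((s - real l * k) / k)) *\<^sub>R \<phi> l) has_integral (\<Sum>l=0..n. v l *\<^sub>R \<phi> l)) {0..t}"
    by (intro has_integral_sum has_integral_scaleR_left v) auto
  moreover have "(\<Sum>l=0..n. v l *\<^sub>R \<phi> l) = quadr k \<beta> \<phi> n"
    unfolding quadr_def by (subst sum.atLeast_Suc_atMost) (simp_all add: v_def)
  ultimately show ?thesis by (simp add: t_def scaleR_sum_right)
qed

lemma sum_hat_eq_linear_interpolation:
  fixes \<phi> :: "nat \<Rightarrow> 'a::real_vector"
  assumes k: "k > 0" and i: "i < n" and s: "real i * k \<le> s" "s \<le> real (Suc i) * k"
  shows "(\<Sum>l=0..n. hat ((s - real l * k) / k) *\<^sub>R \<phi> l)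
    = \<phi> i + ((s - real i * k) / k) *\<^sub>R (\<phi> (Suc i) - \<phi> i)"
proof -
  have far: "hat ((s - real l * k) / k) = 0" if ne: "l \<noteq> i" "l \<noteq> Suc i" for l
  proof (rule hat_eq_0[OF k])
    consider "Suc l \<le> i" | "Suc (Suc i) \<le> l" using ne by linarith
    then show "k \<le> \<bar>s - real l * k\<bar>"
    proof cases
      case 1
      then have "real (Suc l) * k \<le> real i * k" using k by (intro mult_right_mono) auto
      then show ?thesis using s by (simp add: algebra_simps)
    next
      case 2
      then have "real (Suc (Suc i)) * k \<le> real l * k" using k by (intro mult_right_mono) auto
      then show ?thesis using s by (simp add: algebra_simps)
    qed
  qed
  define \<theta> where "\<theta> = (s - real i * k) / k"
  have \<theta>: "0 \<le> \<theta>" "\<theta> \<le> 1" using s k by (auto simp: \<theta>_def field_simps)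
  have "(s - real (Suc i) * k) / k = \<theta> - 1" using k by (simp add: \<theta>_def field_simps)
  then have near: "hat ((s - real i * k) / k) = 1 - \<theta>" "hat ((s - real (Suc i) * k) / k) = \<theta>"
    using \<theta> by (auto simp: hat_def \<theta>_def[symmetric])
  have "(\<Sum>l=0..n. hat ((s - real l * k) / k) *\<^sub>R \<phi> l)
      = (\<Sum>l\<in>{i, Suc i}. hat ((s - real l * k) / k) *\<^sub>R \<phi> l)"
    using i by (intro sum.mono_neutral_right) (auto simp: far)
  also have "\<dots> = (1 - \<theta>) *\<^sub>R \<phi> i + \<theta> *\<^sub>R \<phi> (Suc i)"
    using near by simp
  also have "\<dots> = \<phi> i + \<theta> *\<^sub>R (\<phi> (Suc i) - \<phi> i)"
    by (simp add: algebra_simps)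
  finally show ?thesis unfolding \<theta>_def .
qed

lemma exists_grid_interval:
  assumes k: "k > 0" and n: "n \<ge> 1" and s: "0 \<le> s" "s \<le> real n * k"
  obtains i where "i < n" "real i * k \<le> s" "s \<le> real (Suc i) * k"
  using n s(2)
proof (induction n arbitrary: thesis rule: nat_induct_at_least)
  case base
  then show ?case using s by (intro base(1)[of 0]) auto
next
  case (Suc n)
  show ?case
  proof (cases "s \<le> real n * k")
    case True
    show ?thesis by (rule Suc.IH[OF _ True]) (rule Suc.prems(1)[OF less_SucI])
  next
    case False
    then show ?thesis by (intro Suc.prems(1)[of n]) (use Suc.prems(2) in auto)
  qed
qed

text \<open>By exactness on the interpolant, the error is the convolution of \<beta> with the
  interpolation error, so a bound uniform over the cells is multiplied by the L1 norm of
  \<beta>.\<close>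

lemma quadrature_error_le:
  fixes \<Phi> :: "real \<Rightarrow> 'a::banach"
  assumes \<beta>: "\<And>X. \<beta> absolutely_integrable_on {0..X}" and k: "k > 0" and n: "n \<ge> 1"
    and int: "(\<lambda>s. \<beta> (real n * k - s) *\<^sub>R \<Phi> s) integrable_on {0..real n * k}"
    and M: "\<And>i s. i < n \<Longrightarrow> s \<in> {real i * k..real (Suc i) * k} \<Longrightarrow>
      norm (interp_error \<Phi> (real i * k) (real (Suc i) * k) s) \<le> M"
  shows "norm (integral {0..real n * k} (\<lambda>s. \<beta> (real n * k - s) *\<^sub>R \<Phi> s) - quadr k \<beta> (\<lambda>j. \<Phi> (real j * k)) n)
    \<le> M * integral {0..real n * k} (\<lambda>s. \<bar>\<beta> s\<bar>)"
proof -
  define t where "t = real n * k"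
  define P where "P = (\<lambda>s. \<Sum>l=0..n. hat ((s - real l * k) / k) *\<^sub>R \<Phi> (real l * k))"
  have "((\<lambda>s. \<beta> (t - s) *\<^sub>R \<Phi> s - \<beta> (t - s) *\<^sub>R P s) has_integral
     (integral {0..t} (\<lambda>s. \<beta> (t - s) *\<^sub>R \<Phi> s) - quadr k \<beta> (\<lambda>j. \<Phi> (real j * k)) n)) {0..t}"
    unfolding P_def t_def using int
    by (intro has_integral_diff quadr_has_integral \<beta> k n integrable_integral)
  then have *: "((\<lambda>s. \<beta> (t - s) *\<^sub>R (\<Phi> s - P s)) has_integral
     (integral {0..t} (\<lambda>s. \<beta> (t - s) *\<^sub>R \<Phi> s) - quadr k \<beta> (\<lambda>j. \<Phi> (real j * k)) n)) {0..t}"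
    by (simp add: scaleR_diff_right)
  have "norm (\<Phi> s - P s) \<le> M" if s: "s \<in> {0..t}" for s
  proof -
    obtain i where i: "i < n" "real i * k \<le> s" "s \<le> real (Suc i) * k"
      using exists_grid_interval[OF k n, of s] s by (auto simp: t_def)
    have "real (Suc i) * k - real i * k = k" by (simp add: algebra_simps)
    then have "\<Phi> s - P s = interp_error \<Phi> (real i * k) (real (Suc i) * k) s"
      unfolding P_def sum_hat_eq_linear_interpolation[OF k i] interp_error_def by simp
    then show ?thesis using M[of i s] i by simp
  qed
  from norm_convolution_le[OF \<beta> _ this] *
  have "norm (integral {0..t} (\<lambda>s. \<beta> (t - s) *\<^sub>R (\<Phi> s - P s))) \<le> M * integral {0..t} (\<lambda>s. \<bar>\<beta> s\<bar>)"
    by (auto simp: integrable_on_def)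
  then show ?thesis using integral_unique[OF *] by (simp add: t_def)
qed

section \<open>Truncation error\<close>

text \<open>B is unbounded, so it cannot simply be exchanged with the limit of difference quotients.
  By symmetry the inner product of y with \<open>B (g s)\<close> is that of \<open>B y\<close> with
  \<open>g s\<close>, a bounded functional of \<open>g s\<close>; this yields the weak derivative,
  and continuity of \<open>B (g' t)\<close> makes it strong.\<close>

lemma operator_has_vector_derivative:
  fixes g :: "real \<Rightarrow> 'a::{real_inner,banach}"
  assumes B: "positive_selfadjoint D B"
    and g: "\<And>t. t > 0 \<Longrightarrow> (g has_vector_derivative g' t) (at t)"
    and D: "\<And>t. t > 0 \<Longrightarrow> g t \<in> D" "\<And>t. t > 0 \<Longrightarrow> g' t \<in> D"
    and c: "continuous_on {0<..} (\<lambda>t. B (g' t))" and t: "t > 0"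
  shows "((\<lambda>s. B (g s)) has_vector_derivative B (g' t)) (at t)"
proof (rule weak_derivative_imp_has_vector_derivative[OF _ c _ t])
  show "closure D = UNIV" using B by (simp add: positive_selfadjoint_def)
  fix r y assume r: "(r::real) > 0" and y: "y \<in> D"
  note sym = positive_selfadjoint_symmetric[OF B y]
  have "((\<lambda>s. inner (B y) (g s)) has_vector_derivative inner (B y) (g' r)) (at r)"
    by (rule bounded_linear.has_vector_derivative[OF bounded_linear_inner_right g[OF r]])
  then have "((\<lambda>s. inner (B y) (g s)) has_real_derivative inner y (B (g' r))) (at r)"
    by (simp add: has_real_derivative_iff_has_vector_derivative sym D(2)[OF r])
  then show "((\<lambda>s. inner y (B (g s))) has_real_derivative inner y (B (g' r))) (at r)"
    by (rule has_field_derivative_transform_within_open[of _ _ _ "{0<..}"]) (use r sym D(1) in auto)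
qed

lemma absolutely_integrable_half_line_Icc:
  fixes \<beta> :: "real \<Rightarrow> real"
  assumes "\<beta> absolutely_integrable_on {0<..}"
  shows "\<beta> absolutely_integrable_on {0..X}"
    and "integral {0..X} (\<lambda>s. \<bar>\<beta> s\<bar>) \<le> integral {0<..} (\<lambda>s. \<bar>\<beta> s\<bar>)"
proof -
  have neg: "negligible {x \<in> {0..} - {0<..}. f x \<noteq> 0}" "negligible {x \<in> {0<..} - {0..}. f x \<noteq> 0}"
    for f :: "real \<Rightarrow> real"
    by (rule negligible_subset[of "{0}"]; force)+
  have *: "\<beta> absolutely_integrable_on {0..}"
    using assms absolutely_integrable_spike_set_eq[OF neg] by simp
  then show 1: "\<beta> absolutely_integrable_on {0..X}"
    by (rule set_integrable_subset) auto
  have "integral {0..X} (\<lambda>s. \<bar>\<beta> s\<bar>) \<le> integral {0..} (\<lambda>s. \<bar>\<beta> s\<bar>)"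
    using * 1 by (intro integral_subset_le) (auto simp: absolutely_integrable_on_def)
  also have "\<dots> = integral {0<..} (\<lambda>s. \<bar>\<beta> s\<bar>)"
    by (rule integral_spike_set) (rule neg)+
  finally show "integral {0..X} (\<lambda>s. \<bar>\<beta> s\<bar>) \<le> integral {0<..} (\<lambda>s. \<bar>\<beta> s\<bar>)" .
qed

lemma nn_integral_abs_half_line:
  fixes \<beta> :: "real \<Rightarrow> real"
  assumes "\<beta> absolutely_integrable_on {0<..}"
  shows "(\<integral>\<^sup>+t\<in>{0<..}. ennreal \<bar>\<beta> t\<bar> \<partial>lebesgue) = ennreal (integral {0<..} (\<lambda>s. \<bar>\<beta> s\<bar>))"
proof -
  have "((\<lambda>s. \<bar>\<beta> s\<bar>) has_integral integral {0<..} (\<lambda>s. \<bar>\<beta> s\<bar>)) {0<..}"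
    using assms by (intro integrable_integral) (simp add: absolutely_integrable_on_def)
  from nn_integral_has_integral_lebesgue'[OF _ this] show ?thesis
    by (simp add: nn_integral_completion)
qed

text \<open>\<open>finite_initial\<close> is not a hypothesis of the theorem; the theorem enters the
  locale only in the case where it holds.\<close>

locale scheme_solution =
  fixes D :: "nat \<Rightarrow> 'a::{real_inner,banach} set"
    and B :: "nat \<Rightarrow> 'a \<Rightarrow> 'a"
    and \<beta> :: "nat \<Rightarrow> real \<Rightarrow> real"
    and f u ut utt uttt :: "real \<Rightarrow> 'a" and u0 :: 'a and k :: real and U :: "nat \<Rightarrow> 'a"
  assumes B: "\<And>q. q \<in> {1..2} \<Longrightarrow> positive_selfadjoint (D q) (B q)"
    and \<beta>: "\<And>q. q \<in> {1..2} \<Longrightarrow> \<beta> q absolutely_integrable_on {0<..}"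
    and f: "continuous_on {0..} f"
    and volterra: "volterra_solution \<beta> D B f u0 u"
    and regular: "regular_solution D B u ut utt uttt"
    and k: "k > 0"
    and scheme: "cn_scheme \<beta> D B f u0 k U"
    and finite_initial: "\<And>q. q \<in> {1..2} \<Longrightarrow> (\<integral>\<^sup>+\<zeta>\<in>{0..k}. ennreal (norm (B q (ut \<zeta>))) \<partial>lebesgue) < \<infinity>"
begin

section \<open>Regularity of the exact solution\<close>

lemma u_continuous_initial:
  shows "continuous_on {0..} u" "u 0 = u0"
    and u_domain: "\<And>q t. q \<in> {1..2} \<Longrightarrow> t \<ge> 0 \<Longrightarrow> u t \<in> D q"
  using volterra by (simp_all add: volterra_solution_def)

lemma memory_integrable:
  "q \<in> {1..2} \<Longrightarrow> t > 0 \<Longrightarrow> (\<lambda>s. \<beta> q (t - s) *\<^sub>R B q (u s)) integrable_on {0..t}"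
  using volterra by (simp add: volterra_solution_def)

lemma u_equation:
  assumes "t > 0"
  shows "ut t + (\<Sum>q=1..2. integral {0..t} (\<lambda>s. \<beta> q (t - s) *\<^sub>R B q (u s))) = f t"
proof -
  have "vector_derivative u (at t) = ut t"
    using regular assms by (intro vector_derivative_at) (simp add: regular_solution_def)
  moreover have "vector_derivative u (at t)
      + (\<Sum>q=1..2. integral {0..t} (\<lambda>s. \<beta> q (t - s) *\<^sub>R B q (u s))) = f t"
    using volterra assms by (simp add: volterra_solution_def)
  ultimately show ?thesis by simp
qed

lemma regular_facts:
  assumes "t > 0"
  shows "(u has_vector_derivative ut t) (at t)" "(ut has_vector_derivative utt t) (at t)"
    "(utt has_vector_derivative uttt t) (at t)"
  using assms regular by (auto simp: regular_solution_def)

lemma regular_domain: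
  assumes "q \<in> {1..2}"
  shows "\<And>t. t > 0 \<Longrightarrow> ut t \<in> D q" "\<And>t. t > 0 \<Longrightarrow> utt t \<in> D q"
    "continuous_on {0<..} (\<lambda>t. B q (utt t))"
  using assms regular unfolding regular_solution_def by blast+

text \<open>Regularity descends from the top: \<open>B q (utt t)\<close> is continuous by
  assumption, which makes \<open>B q (ut t)\<close> differentiable and so continuous, and this in
  turn is what \<open>Bu_derivative\<close> requires.\<close>

lemma But_derivative:
  assumes q: "q \<in> {1..2}" and "t > 0"
  shows "((\<lambda>s. B q (ut s)) has_vector_derivative B q (utt t)) (at t)"
  by (rule operator_has_vector_derivative[OF B[OF q] regular_facts(2) _ _ _ assms(2)])
    (use regular_domain[OF q] in auto)

lemma continuous_on_derivatives:
  shows "continuous_on {0<..} utt" "continuous_on {0<..} uttt"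
    and "\<And>q. q \<in> {1..2} \<Longrightarrow> continuous_on {0<..} (\<lambda>t. B q (ut t))"
proof -
  show "continuous_on {0<..} uttt" using regular by (simp add: regular_solution_def)
qed (rule continuous_on_vector_derivative,
    rule has_vector_derivative_at_within[OF regular_facts(3)]
      has_vector_derivative_at_within[OF But_derivative], simp+)+

lemma Bu_derivative:
  assumes q: "q \<in> {1..2}" and "t > 0"
  shows "((\<lambda>s. B q (u s)) has_vector_derivative B q (ut t)) (at t)"
  by (rule operator_has_vector_derivative[OF B[OF q] regular_facts(1) _ _ _ assms(2)])
    (use regular_domain[OF q] u_domain[OF q] continuous_on_derivatives(3)[OF q] in auto)

section \<open>Local errors on a fixed grid\<close>

definition I0 :: "nat \<Rightarrow> ennreal" where
  "I0 q = (\<integral>\<^sup>+\<zeta>\<in>{0..k}. ennreal (norm (B q (ut \<zeta>))) \<partial>lebesgue)"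

definition I1 :: "nat \<Rightarrow> nat \<Rightarrow> ennreal" where
  "I1 q n = (\<integral>\<^sup>+\<zeta>\<in>{k..real n * k}. ennreal (norm (B q (utt \<zeta>))) \<partial>lebesgue)"

definition J :: "nat \<Rightarrow> ennreal" where
  "J n = (\<integral>\<^sup>+\<zeta>\<in>{(real n - 1) * k..real n * k}. ennreal (norm (uttt \<zeta>)) \<partial>lebesgue)"

definition J1 :: ennreal where
  "J1 = (\<integral>\<^sup>+\<zeta>\<in>{0..k}. ennreal (norm (utt \<zeta>)) \<partial>lebesgue)"

definition L1 :: "nat \<Rightarrow> real" where
  "L1 q = integral {0<..} (\<lambda>s. \<bar>\<beta> q s\<bar>)"

definition memory :: "nat \<Rightarrow> real \<Rightarrow> 'a" where
  "memory q t = integral {0..t} (\<lambda>s. \<beta> q (t - s) *\<^sub>R B q (u s))"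

definition quadr_error :: "nat \<Rightarrow> nat \<Rightarrow> 'a" where
  "quadr_error q j = memory q (real j * k) - quadr k (\<beta> q) (\<lambda>i. B q (u (real i * k))) j"

text \<open>The scheme uses \<open>f\<close> at time 0, where the differential equation is not assumed; the value
  of \<open>u'\<close> there is therefore taken from \<open>f\<close>.\<close>

definition u' :: "real \<Rightarrow> 'a" where
  "u' t = (if t = 0 then f 0 else ut t)"

text \<open>The residual of the error sequence in the scheme, so that the stability estimate applies
  by definition. \<open>\<tau>_eq\<close> then expresses it through u alone.\<close>

definition \<tau> :: "nat \<Rightarrow> 'a" where
  "\<tau> n = diffq k (\<lambda>j. U j - u (real j * k)) n
     + (\<Sum>q=1..2. mid (quadr k (\<beta> q) (\<lambda>j. B q (U j - u (real j * k)))) n)"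

text \<open>Norm continuity of \<open>B q (u s)\<close> at 0 is not given. But u is continuous
  there, so tested with y in the domain these values converge, and the increment bounds on {a..s}
  survive a tending to 0.\<close>

lemma Bu_increment_from_zero:
  assumes q: "q \<in> {1..2}" and s: "s \<in> {0..k}"
  shows "norm (B q (u s) - B q (u 0)) \<le> enn2real (I0 q)"
proof (cases "s = 0")
  case False
  then have s0: "s > 0" using s by simp
  have I: "ennreal (enn2real (I0 q)) = I0 q"
    using finite_initial[OF q] by (simp add: I0_def)
  have incr: "norm (B q (u s) - B q (u a)) \<le> enn2real (I0 q)" if a: "0 < a" "a \<le> s" for a
  proof -
    have "ennreal (norm (B q (u s) - B q (u a))) \<le> ennreal (enn2real (I0 q))"
      unfolding I unfolding I0_def
      by (rule norm_increment_le_nn_integral[where g = "\<lambda>s. B q (u s)" and g' = "\<lambda>s. B q (ut s)"])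
        (use a s Bu_derivative[OF q] in \<open>auto intro: continuous_on_subset[OF continuous_on_derivatives(3)[OF q]]\<close>)
    then show ?thesis by simp
  qed
  have "closure (D q) = UNIV" using B[OF q] by (simp add: positive_selfadjoint_def)
  then show ?thesis
  proof (rule norm_le_of_dense_inner)
    fix y assume y: "y \<in> D q"
    note sym = positive_selfadjoint_symmetric[OF B[OF q] y u_domain[OF q]]
    have "(u \<longlongrightarrow> u 0) (at 0 within {0..})"
      using u_continuous_initial(1) by (simp add: continuous_on)
    then have "(u \<longlongrightarrow> u 0) (at_right 0)" by (rule tendsto_within_subset) auto
    then have lim: "((\<lambda>a. inner y (B q (u s)) - inner (B q y) (u a)) \<longlongrightarrow> inner y (B q (u s)) - inner (B q y) (u 0)) (at_right 0)"
      by (intro tendsto_intros)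
    have "\<forall>\<^sub>F a in at_right 0. a \<in> {0<..<s}"
      using s0 by (rule eventually_at_right_real)
    then have "\<forall>\<^sub>F a in at_right 0. inner y (B q (u s)) - inner (B q y) (u a) \<le> enn2real (I0 q) * norm y"
    proof eventually_elim
      case (elim a)
      then have "inner y (B q (u s)) - inner (B q y) (u a) = inner y (B q (u s) - B q (u a))"
        by (simp add: sym inner_diff_right)
      also have "\<dots> \<le> norm y * norm (B q (u s) - B q (u a))" by (rule norm_cauchy_schwarz)
      also have "\<dots> \<le> norm y * enn2real (I0 q)"
        using elim by (intro mult_left_mono incr) auto
      finally show ?case by (simp add: mult.commute)
    qed
    with lim have "inner y (B q (u s)) - inner (B q y) (u 0) \<le> enn2real (I0 q) * norm y"
      by (rule tendsto_upperbound) simp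
    then show "inner y (B q (u s) - B q (u 0)) \<le> enn2real (I0 q) * norm y"
      by (simp add: sym inner_diff_right)
  qed simp
qed simp

text \<open>On {0..k} the values \<open>B q (u s)\<close> are bounded, and the integral of the
  absolute kernel over {0..t} tends to 0 even if the kernel is singular.\<close>

lemma memory_tendsto_zero:
  assumes q: "q \<in> {1..2}"
  shows "(memory q \<longlongrightarrow> 0) (at_right 0)"
proof -
  define M where "M = norm (B q (u 0)) + enn2real (I0 q)"
  have M: "norm (B q (u s)) \<le> M" if "s \<in> {0..k}" for s
    using Bu_increment_from_zero[OF q that] norm_triangle_sub[of "B q (u s)" "B q (u 0)"]
    by (simp add: M_def)
  note \<beta>' = absolutely_integrable_half_line_Icc(1)[OF \<beta>[OF q]]
  have "continuous_on {0..k} (\<lambda>t. integral {0..t} (\<lambda>s. \<bar>\<beta> q s\<bar>))"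
    using \<beta>'[of k] by (intro indefinite_integral_continuous_1) (simp add: absolutely_integrable_on_def)
  from this[unfolded continuous_on, rule_format, of 0]
  have "((\<lambda>t. integral {0..t} (\<lambda>s. \<bar>\<beta> q s\<bar>)) \<longlongrightarrow> 0) (at 0 within {0..k})"
    using k by simp
  then have "((\<lambda>t. M * integral {0..t} (\<lambda>s. \<bar>\<beta> q s\<bar>)) \<longlongrightarrow> M * 0) (at_right 0)"
    using k by (intro tendsto_mult_left) (simp add: at_within_Icc_at_right)
  from this[unfolded mult_zero_right] show ?thesis
  proof (rule tendsto_0_le[where K = 1])
    have "\<forall>\<^sub>F t in at_right 0. t \<in> {0<..<k}"
      using k by (rule eventually_at_right_real)
    then show "\<forall>\<^sub>F t in at_right 0. norm (memory q t) \<le> norm (M * integral {0..t} (\<lambda>s. \<bar>\<beta> q s\<bar>)) * 1"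
    proof eventually_elim
      case (elim t)
      have "norm (memory q t) \<le> M * integral {0..t} (\<lambda>s. \<bar>\<beta> q s\<bar>)"
        unfolding memory_def using elim
        by (intro norm_convolution_le \<beta>' memory_integrable[OF q] M) auto
      then show ?case by simp
    qed
  qed
qed

text \<open>Justifies the value of \<open>u'\<close> at 0: estimates for ut on {0<..k} extend to the
  closed first cell.\<close>

lemma ut_tendsto: "(ut \<longlongrightarrow> f 0) (at_right 0)"
proof -
  have "(f \<longlongrightarrow> f 0) (at 0 within {0..})"
    using f by (simp add: continuous_on)
  then have "(f \<longlongrightarrow> f 0) (at_right 0)" by (rule tendsto_within_subset) auto
  then have "((\<lambda>t. f t - (\<Sum>q=1..2. memory q t)) \<longlongrightarrow> f 0 - (\<Sum>q=1..(2::nat). 0)) (at_right 0)"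
    by (intro tendsto_intros memory_tendsto_zero)
  then have "((\<lambda>t. f t - (\<Sum>q=1..2. memory q t)) \<longlongrightarrow> f 0) (at_right 0)" by simp
  then show ?thesis
  proof (rule Lim_transform_eventually)
    have "\<forall>\<^sub>F t in at_right (0::real). t > 0" by (simp add: eventually_at_right_less)
    then show "\<forall>\<^sub>F t in at_right 0. f t - (\<Sum>q=1..2. memory q t) = ut t"
    proof eventually_elim
      case (elim t)
      show ?case using u_equation[OF elim] by (simp add: memory_def algebra_simps)
    qed
  qed
qed

text \<open>The first cell uses the increment of \<open>B q (u s)\<close>, the later ones the
  second-order interpolation error; the sum of both bounds serves all cells. Allowing j \<le> n
  gives the two quadratures averaged at step n the same bound.\<close>

lemma quadr_error_le:
  assumes q: "q \<in> {1..2}" and j: "j \<le> n" "n \<ge> 1"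
  shows "ennreal (norm (quadr_error q j)) \<le> 2 * (ennreal (L1 q) * (I0 q + ennreal k * I1 q n))"
proof (cases "j = 0")
  \<comment> \<open>At j = 0 the memory integral is over a point and the quadrature is zero because
    \<open>chi0\<close> vanishes for n = 0.\<close>
  case True
  then show ?thesis by (simp add: quadr_error_def memory_def quadr_def chi0_def)
next
  case False
  define i0 where "i0 = enn2real (I0 q)"
  define i1 where "i1 = enn2real (I1 q n)"
  have i0: "I0 q = ennreal i0" "i0 \<ge> 0" using finite_initial[OF q] by (simp_all add: I0_def i0_def)
  have "continuous_on {k..real n * k} (\<lambda>t. B q (utt t))"
    by (rule continuous_on_subset[OF regular_domain(3)[OF q]]) (use k in auto)
  from nn_integral_norm_finite[OF this] have i1: "I1 q n = ennreal i1" "i1 \<ge> 0"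
    by (simp_all add: I1_def i1_def)
  note \<beta>' = absolutely_integrable_half_line_Icc[OF \<beta>[OF q]]
  define M where "M = 2 * (i0 + k * i1)"
  have M0: "M \<ge> 0" using i0 i1 k by (simp add: M_def)
  have L0: "L1 q \<ge> 0"
    using \<beta>[OF q] unfolding L1_def absolutely_integrable_on_def
    by (intro Henstock_Kurzweil_Integration.integral_nonneg) auto
  have "norm (quadr_error q j) \<le> M * integral {0..real j * k} (\<lambda>s. \<bar>\<beta> q s\<bar>)"
    unfolding quadr_error_def memory_def
  proof (rule quadrature_error_le[OF \<beta>'(1) k])
    show "j \<ge> 1" using False by simp
    show "(\<lambda>s. \<beta> q (real j * k - s) *\<^sub>R B q (u s)) integrable_on {0..real j * k}"
      using False k by (intro memory_integrable[OF q]) simp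
    fix i s assume i: "i < j" and s: "s \<in> {real i * k..real (Suc i) * k}"
    show "norm (interp_error (\<lambda>t. B q (u t)) (real i * k) (real (Suc i) * k) s) \<le> M"
    proof (cases "i = 0")
      case True
      then have "norm (interp_error (\<lambda>t. B q (u t)) (real i * k) (real (Suc i) * k) s) \<le> 2 * i0"
        using k s Bu_increment_from_zero[OF q] by (intro interp_error_le) (auto simp: i0_def)
      also have "\<dots> \<le> M" using i1 k by (simp add: M_def)
      finally show ?thesis .
    next
      case False
      define a where "a = real i * k"
      define b where "b = real (Suc i) * k"
      have ba: "b - a = k" by (simp add: a_def b_def algebra_simps)
      have ka: "k \<le> a" using False k by (simp add: a_def)
      have "b \<le> real n * k" using i j k unfolding b_def by (intro mult_right_mono) auto
      then have sub: "{a..b} \<subseteq> {k..real n * k}" using ka by auto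
      have "norm (B q (ut t) - B q (ut b)) \<le> i1" if t: "a \<le> t" "t \<le> b" for t
      proof -
        have "ennreal (norm (B q (ut b) - B q (ut t))) \<le> I1 q n"
          unfolding I1_def
          by (rule norm_increment_le_nn_integral[where g = "\<lambda>s. B q (ut s)" and g' = "\<lambda>s. B q (utt s)"])
            (use t ka k sub in \<open>auto intro!: But_derivative[OF q] continuous_on_subset[OF regular_domain(3)[OF q]]\<close>)
        then have "norm (B q (ut b) - B q (ut t)) \<le> i1" using i1 by simp
        then show ?thesis by (simp add: norm_minus_commute)
      qed
      then have "norm (interp_error (\<lambda>t. B q (u t)) a b s) \<le> 2 * (b - a) * i1"
        using ba ka k s[folded a_def b_def]
        by (intro interp_error_second_order[where \<phi>' = "\<lambda>s. B q (ut s)"] Bu_derivative[OF q]) auto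
      also have "\<dots> \<le> M" using i0 ba by (simp add: M_def)
      finally show ?thesis by (simp add: a_def b_def)
    qed
  qed
  also have "\<dots> \<le> M * L1 q"
    using M0 \<beta>'(2) by (intro mult_left_mono) (auto simp: L1_def)
  finally have "ennreal (norm (quadr_error q j)) \<le> ennreal (M * L1 q)" by (rule ennreal_leI)
  also have "M * L1 q = 2 * (L1 q * (i0 + k * i1))" by (simp add: M_def)
  also have "ennreal \<dots> = 2 * (ennreal (L1 q) * (I0 q + ennreal k * I1 q n))"
    using i0 i1 L0 k by (simp add: ennreal_mult)
  finally show ?thesis .
qed

text \<open>For n = 1 only the variation of \<open>u'\<close> is used, since uttt may fail to be
  integrable near 0; for n \<ge> 2 the variation of utt is available and yields the extra factor k.
  The constant 3/2 is rounded up to 2.\<close>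

lemma trapezoid_le:
  assumes n: "n \<ge> 1"
  shows "ennreal (norm (mid (\<lambda>j. u' (real j * k)) n - diffq k (\<lambda>j. u (real j * k)) n))
    \<le> 2 * (if n = 1 then J1 else ennreal k * J n)"
proof -
  define a where "a = real (n - 1) * k"
  define b where "b = real n * k"
  have b: "b = a + k" using n by (simp add: a_def b_def of_nat_diff algebra_simps)
  have a0: "a \<ge> 0" using k by (simp add: a_def)
  define T where "T = u b - u a - (k / 2) *\<^sub>R (u' a + u' b)"
  have "mid (\<lambda>j. u' (real j * k)) n - diffq k (\<lambda>j. u (real j * k)) n = - ((1 / k) *\<^sub>R T)"
    unfolding mid_def diffq_def T_def a_def[symmetric] b_def[symmetric]
    using k by (simp add: scaleR_diff_right scaleR_add_right algebra_simps)
  then have norm: "norm (mid (\<lambda>j. u' (real j * k)) n - diffq k (\<lambda>j. u (real j * k)) n) = norm T / k"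
    using k by simp
  show ?thesis
  proof (cases "n = 1")
    case True
    then have ab: "a = 0" "b = k" by (simp_all add: a_def b_def)
    show ?thesis
    proof (cases "J1 = \<infinity>")
      case True
      then show ?thesis using \<open>n = 1\<close> by (simp add: ennreal_mult_top)
    next
      case False
      define j where "j = enn2real J1"
      have j: "J1 = ennreal j" "j \<ge> 0" using False by (simp_all add: j_def less_top)
      have incr: "norm (ut t - ut k) \<le> j" if t: "0 < t" "t \<le> k" for t
      proof -
        have "ennreal (norm (ut k - ut t)) \<le> J1"
          unfolding J1_def
          by (rule norm_increment_le_nn_integral[where g = ut and g' = utt])
            (use t in \<open>auto intro!: regular_facts(2) continuous_on_subset[OF continuous_on_derivatives(1)]\<close>)
        then show ?thesis using j by (simp add: norm_minus_commute)
      qed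
      have "((\<lambda>t. norm (ut t - ut k)) \<longlongrightarrow> norm (f 0 - ut k)) (at_right 0)"
        by (intro tendsto_intros ut_tendsto)
      moreover have "\<forall>\<^sub>F t in at_right 0. t \<in> {0<..<k}"
        using k by (rule eventually_at_right_real)
      then have "\<forall>\<^sub>F t in at_right 0. norm (ut t - ut k) \<le> j"
        by eventually_elim (auto intro: incr)
      ultimately have "norm (f 0 - ut k) \<le> j" by (rule tendsto_upperbound) simp
      then have incr': "norm (u' t - u' k) \<le> j" if "0 \<le> t" "t \<le> k" for t
        using that incr[of t] k by (auto simp: u'_def)
      have "norm (u k - u 0 - ((k - 0) / 2) *\<^sub>R (u' 0 + u' k)) \<le> 3 / 2 * (k - 0) * j"
      proof (rule trapezoid_error_first_order)
        show "continuous_on {0..k} u" by (rule continuous_on_subset[OF u_continuous_initial(1)]) auto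
        show "(u has_vector_derivative u' t) (at t)" if "0 < t" for t
          using regular_facts(1)[OF that] that by (simp add: u'_def)
      qed (use k incr' in auto)
      then have "norm T \<le> 3 / 2 * k * j" by (simp only: T_def ab diff_zero)
      also have "\<dots> \<le> 2 * j * k" using k j(2) by simp
      finally have "norm T / k \<le> 2 * j" using k by (simp add: pos_divide_le_eq)
      then have "ennreal (norm T / k) \<le> ennreal (2 * j)" by (rule ennreal_leI)
      also have "\<dots> = 2 * J1" using j by (simp add: ennreal_mult)
      finally show ?thesis using True norm by simp
    qed
  next
    case False
    then have "n \<ge> 2" using n by simp
    then have a1: "a > 0" using k by (simp add: a_def)
    have Jn: "J n = (\<integral>\<^sup>+\<zeta>\<in>{a..b}. ennreal (norm (uttt \<zeta>)) \<partial>lebesgue)"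
      using n by (simp add: J_def a_def b_def of_nat_diff)
    have sub: "{a..b} \<subseteq> {0<..}" using a1 by auto
    define j where "j = enn2real (J n)"
    have j: "J n = ennreal j" "j \<ge> 0"
      using nn_integral_norm_finite[OF continuous_on_subset[OF continuous_on_derivatives(2) sub]]
      by (simp_all add: j_def Jn)
    have incr: "norm (utt t - utt b) \<le> j" if t: "a \<le> t" "t \<le> b" for t
    proof -
      have "ennreal (norm (utt b - utt t)) \<le> J n"
        unfolding Jn
        by (rule norm_increment_le_nn_integral[where g = utt and g' = uttt])
          (use t a1 in \<open>auto intro!: regular_facts(3) continuous_on_subset[OF continuous_on_derivatives(2)]\<close>)
      then show ?thesis using j by (simp add: norm_minus_commute)
    qed
    have "norm (u b - u a - ((b - a) / 2) *\<^sub>R (ut a + ut b)) \<le> 3 / 2 * (b - a)\<^sup>2 * j"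
      using a1 k b by (intro trapezoid_error_second_order[where z = utt] regular_facts incr) auto
    then have "norm T \<le> 3 / 2 * k\<^sup>2 * j"
      using a1 k b by (simp add: T_def u'_def)
    then have "norm T / k \<le> 3 / 2 * k\<^sup>2 * j / k" using k by (intro divide_right_mono) auto
    also have "\<dots> = 3 / 2 * (k * j)" using k by (simp add: power2_eq_square)
    also have "\<dots> \<le> 2 * (k * j)" using k j(2) by (intro mult_right_mono) auto
    finally have "ennreal (norm T / k) \<le> ennreal (2 * (k * j))" by (rule ennreal_leI)
    also have "\<dots> = 2 * (ennreal k * J n)" using j k by (simp add: ennreal_mult)
    finally show ?thesis using False norm by simp
  qed
qed

lemma \<tau>_eq:
  assumes n: "n \<ge> 1"
  shows "\<tau> n = (mid (\<lambda>j. u' (real j * k)) n - diffq k (\<lambda>j. u (real j * k)) n)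
    + (\<Sum>q=1..2. mid (quadr_error q) n)"
proof -
  define v where "v = (\<lambda>j. u (real j * k))"
  have UD: "U j \<in> D q" "v j \<in> D q" if "q \<in> {1..2}" for q j
    using scheme that u_domain[OF that] k unfolding cn_scheme_def v_def by auto
  \<comment> \<open>For j = 0 this holds by the choice of \<open>u'\<close> at 0, since the memory
    integral is zero.\<close>
  have fj: "f (real j * k) = u' (real j * k) + (\<Sum>q=1..2. memory q (real j * k))" for j
    using u_equation[of "real j * k"] k by (cases "j = 0") (simp_all add: u'_def memory_def)
  have Q: "quadr k (\<beta> q) (\<lambda>j. B q (U j - v j)) i
      = quadr k (\<beta> q) (\<lambda>j. B q (U j)) i - quadr k (\<beta> q) (\<lambda>j. B q (v j)) i" if "q \<in> {1..2}" for q i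
    using positive_selfadjoint_diff[OF B[OF that] UD[OF that]]
    by (simp add: quadr_def scaleR_diff_right sum_subtractf)
  have mQ: "mid (quadr k (\<beta> q) (\<lambda>j. B q (U j - v j))) n
      = mid (quadr k (\<beta> q) (\<lambda>j. B q (U j))) n - mid (quadr k (\<beta> q) (\<lambda>j. B q (v j))) n"
    if "q \<in> {1..2}" for q
    unfolding mid_def Q[OF that] by (simp add: scaleR_diff_right scaleR_add_right)
  have mE: "mid (quadr_error q) n = mid (\<lambda>j. memory q (real j * k)) n - mid (quadr k (\<beta> q) (\<lambda>j. B q (v j))) n" for q
    unfolding mid_def quadr_error_def v_def by (simp add: scaleR_diff_right scaleR_add_right)
  have mf: "mid (\<lambda>j. f (real j * k)) n = mid (\<lambda>j. u' (real j * k)) n + (\<Sum>q=1..2. mid (\<lambda>j. memory q (real j * k)) n)"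
    unfolding fj mid_def by (simp add: scaleR_add_right scaleR_sum_right sum.distrib)
  have d: "diffq k (\<lambda>j. U j - v j) n = diffq k U n - diffq k v n"
    by (simp add: diffq_def scaleR_diff_right)
  have "\<tau> n = diffq k (\<lambda>j. U j - v j) n + (\<Sum>q=1..2. mid (quadr k (\<beta> q) (\<lambda>j. B q (U j - v j))) n)"
    by (simp add: \<tau>_def v_def)
  also have "\<dots> = (diffq k U n + (\<Sum>q=1..2. mid (quadr k (\<beta> q) (\<lambda>j. B q (U j))) n))
      - diffq k v n - (\<Sum>q=1..2. mid (quadr k (\<beta> q) (\<lambda>j. B q (v j))) n)"
    by (simp add: d mQ sum_subtractf)
  also have "diffq k U n + (\<Sum>q=1..2. mid (quadr k (\<beta> q) (\<lambda>j. B q (U j))) n) = mid (\<lambda>j. f (real j * k)) n"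
    using scheme n by (simp add: cn_scheme_def)
  finally show ?thesis
    unfolding mf mE v_def[symmetric] by (simp add: sum_subtractf)
qed

lemma truncation_error_le:
  assumes n: "n \<ge> 1"
  shows "ennreal (norm (\<tau> n)) \<le> 2 * ((if n = 1 then J1 else ennreal k * J n)
    + (\<Sum>q=1..2. ennreal (L1 q) * (I0 q + ennreal k * I1 q n)))"
proof -
  define R where "R = (\<lambda>q. ennreal (L1 q) * (I0 q + ennreal k * I1 q n))"
  have midE: "ennreal (norm (mid (quadr_error q) n)) \<le> 2 * R q" if q: "q \<in> {1..2}" for q
  proof -
    have "norm (mid (quadr_error q) n) \<le> max (norm (quadr_error q n)) (norm (quadr_error q (n - 1)))"
      using norm_triangle_ineq[of "quadr_error q n" "quadr_error q (n - 1)"]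
      by (simp add: mid_def max_def)
    then have "ennreal (norm (mid (quadr_error q) n))
        \<le> ennreal (max (norm (quadr_error q n)) (norm (quadr_error q (n - 1))))"
      by (rule ennreal_leI)
    also have "\<dots> \<le> 2 * R q"
      using quadr_error_le[OF q _ n, of n] quadr_error_le[OF q _ n, of "n - 1"]
      by (simp add: R_def max_def)
    finally show ?thesis .
  qed
  define A where "A = mid (\<lambda>j. u' (real j * k)) n - diffq k (\<lambda>j. u (real j * k)) n"
  have "norm (\<tau> n) \<le> norm A + (\<Sum>q=1..2. norm (mid (quadr_error q) n))"
    unfolding \<tau>_eq[OF n] A_def[symmetric]
    by (intro order_trans[OF norm_triangle_ineq] add_left_mono norm_sum)
  then have "ennreal (norm (\<tau> n)) \<le> ennreal (norm A + (\<Sum>q=1..2. norm (mid (quadr_error q) n)))"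
    by (rule ennreal_leI)
  also have "\<dots> = ennreal (norm A) + (\<Sum>q=1..2. ennreal (norm (mid (quadr_error q) n)))"
    by (simp add: ennreal_plus sum_nonneg)
  also have "\<dots> \<le> 2 * (if n = 1 then J1 else ennreal k * J n) + (\<Sum>q=1..2. 2 * R q)"
    unfolding A_def by (intro add_mono trapezoid_le[OF n] sum_mono midE) auto
  also have "\<dots> = 2 * ((if n = 1 then J1 else ennreal k * J n) + (\<Sum>q=1..2. R q))"
    by (simp only: distrib_left sum_distrib_left)
  finally show ?thesis by (simp only: R_def)
qed

lemma error_stability:
  assumes pos: "\<And>q. q \<in> {1..2} \<Longrightarrow> positive_type (\<beta> q)"
  shows "norm (U N - u (real N * k)) \<le> 2 * k * (\<Sum>n=1..N. norm (\<tau> n))"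
proof -
  define e where "e = (\<lambda>j. U j - u (real j * k))"
  have "norm (e N) \<le> 2 * k * (\<Sum>n=1..N. norm (\<tau> n))"
  proof (rule crank_nicolson_stability[OF k, where Q = "{1..2}" and \<beta> = \<beta> and B = B and D = D])
    show "e n \<in> D q" if q: "q \<in> {1..2}" for q n
      using positive_selfadjoint_diff[OF B[OF q], of "U n" "u (real n * k)"] scheme q
        u_domain[OF q] k by (auto simp: e_def cn_scheme_def)
    show "e 0 = 0" using scheme u_continuous_initial(2) by (simp add: e_def cn_scheme_def)
    show "0 \<le> (\<Sum>n=1..N. \<Sum>l=1..n. weight k (\<beta> q) (n - l) * a l * a n)" if q: "q \<in> {1..2}" for q N a
      by (rule positive_type_convolution_nonneg[OF absolutely_integrable_half_line_Icc(1)[OF \<beta>[OF q]] pos[OF q] k])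
    show "diffq k e n + (\<Sum>q=1..2. mid (quadr k (\<beta> q) (\<lambda>j. B q (e j))) n) = \<tau> n" for n
      by (simp only: \<tau>_def e_def)
  qed (rule B)
  then show ?thesis by (simp add: e_def)
qed

end

section \<open>The error estimate\<close>

lemma infsum_ennreal_eq_suminf:
  fixes f :: "nat \<Rightarrow> ennreal"
  shows "infsum f A = (\<Sum>n. if n \<in> A then f n else 0)"
proof -
  have "((\<lambda>n. if n \<in> A then f n else 0) has_sum infsum (\<lambda>n. if n \<in> A then f n else 0) UNIV) UNIV"
    by (intro has_sum_infsum nonneg_summable_on_complete) simp
  then have "infsum (\<lambda>n. if n \<in> A then f n else 0) UNIV = (\<Sum>n. if n \<in> A then f n else 0)"
    by (intro sums_unique has_sum_imp_sums)
  moreover have "infsum (\<lambda>n. if n \<in> A then f n else 0) UNIV = infsum f A"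
    by (rule infsum_cong_neutral) auto
  ultimately show ?thesis by simp
qed

lemma infsum_ennreal_cmult:
  fixes f :: "nat \<Rightarrow> ennreal"
  shows "(\<Sum>\<^sub>\<infinity>n\<in>A. c * f n) = c * infsum f A"
  unfolding infsum_ennreal_eq_suminf ennreal_suminf_cmult[symmetric]
  by (intro suminf_cong) simp

lemma infsum_ennreal_add:
  fixes f g :: "'i \<Rightarrow> ennreal"
  shows "(\<Sum>\<^sub>\<infinity>n\<in>A. f n + g n) = infsum f A + infsum g A"
  by (intro infsum_add nonneg_summable_on_complete) simp_all

lemma infsum_ennreal_sum:
  fixes f :: "'j \<Rightarrow> 'i \<Rightarrow> ennreal"
  shows "(\<Sum>\<^sub>\<infinity>n\<in>A. \<Sum>q\<in>Q. f q n) = (\<Sum>q\<in>Q. infsum (f q) A)"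
  by (induction Q rule: infinite_finite_induct) (simp_all add: infsum_ennreal_add)

lemma infsum_ennreal_mono:
  fixes f g :: "'i \<Rightarrow> ennreal"
  shows "(\<And>n. n \<in> A \<Longrightarrow> f n \<le> g n) \<Longrightarrow> infsum f A \<le> infsum g A"
  by (intro infsum_mono nonneg_summable_on_complete) simp_all

lemma member_le_infsum_ennreal:
  fixes f :: "'i \<Rightarrow> ennreal"
  assumes "n \<in> A"
  shows "f n \<le> infsum f A"
proof -
  have "infsum f {n} \<le> infsum f A"
    by (intro infsum_mono_neutral nonneg_summable_on_complete) (use assms in auto)
  then show ?thesis by simp
qed

text \<open>The limit of \<beta> at 0 is strictly positive, so \<beta> is positive on some interval
  to the right of 0. The fact excludes the product 0 * \<infinity> = 0, which would make an infinite
  sum on the right-hand side of the estimate disappear.\<close>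

lemma admissible_kernel_nn_integral_pos:
  assumes adm: "admissible_kernel \<beta>" and int: "\<beta> absolutely_integrable_on {0<..}"
  shows "(\<integral>\<^sup>+t\<in>{0<..}. ennreal \<bar>\<beta> t\<bar> \<partial>lebesgue) \<noteq> 0"
proof
  assume 0: "(\<integral>\<^sup>+t\<in>{0<..}. ennreal \<bar>\<beta> t\<bar> \<partial>lebesgue) = 0"
  obtain \<beta>inf \<beta>0 :: ereal where lim: "((\<lambda>t. ereal (\<beta> t)) \<longlongrightarrow> \<beta>0) (at_right 0)"
    and pos: "0 \<le> \<beta>inf" "\<beta>inf < \<beta>0"
    using adm unfolding admissible_kernel_def by blast
  have "0 < \<beta>0" using pos by (rule order.strict_trans1)
  with lim have "\<forall>\<^sub>F t in at_right 0. 0 < ereal (\<beta> t)" by (rule order_tendstoD)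
  then obtain d where d: "d > 0" "\<And>t. 0 < t \<Longrightarrow> t < d \<Longrightarrow> 0 < \<beta> t"
    unfolding eventually_at_right_field by auto
  have meas: "(\<lambda>t. indicator {0<..} t *\<^sub>R \<beta> t) \<in> borel_measurable lebesgue"
    using int unfolding set_integrable_def by (rule borel_measurable_integrable)
  have eq: "ennreal \<bar>\<beta> t\<bar> * indicator {0<..} t = ennreal \<bar>indicator {0<..} t *\<^sub>R \<beta> t\<bar>" for t
    by (simp add: indicator_def)
  have "AE t in lebesgue. ennreal \<bar>indicator {0<..} t *\<^sub>R \<beta> t\<bar> = 0"
    using 0 meas unfolding eq by (subst (asm) nn_integral_0_iff_AE) auto
  then have "AE t in lebesgue. t \<notin> {0<..<d}"
  proof eventually_elim
    case (elim t)
    then show ?case using d(2)[of t] by (auto simp: indicator_def)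
  qed
  then have "{0<..<d} \<in> null_sets lebesgue"
    by (subst AE_iff_null_sets) auto
  then have "emeasure lebesgue {0<..<d} = 0" by auto
  then show False using d(1) by simp
qed

lemma (in scheme_solution) weighted_truncation_error_le:
  fixes e :: "nat \<Rightarrow> ennreal"
  shows "(\<Sum>\<^sub>\<infinity>n\<in>{1..}. e n * ennreal (norm (\<tau> n)))
    \<le> 2 * (e 1 * J1 + ennreal k * (\<Sum>\<^sub>\<infinity>n\<in>{2..}. e n * J n)
        + (\<Sum>q=1..2. ennreal (L1 q) * (\<Sum>\<^sub>\<infinity>n\<in>{1..}. e n * (I0 q + ennreal k * I1 q n))))"
proof -
  define a where "a = (\<lambda>n. if n = 1 then J1 else ennreal k * J n)"
  define b where "b = (\<lambda>q n. I0 q + ennreal k * I1 q n)"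
  have "(\<Sum>\<^sub>\<infinity>n\<in>{1..}. e n * ennreal (norm (\<tau> n)))
      \<le> (\<Sum>\<^sub>\<infinity>n\<in>{1..}. 2 * (e n * a n + (\<Sum>q=1..2. ennreal (L1 q) * (e n * b q n))))"
  proof (rule infsum_ennreal_mono)
    fix n :: nat assume "n \<in> {1..}"
    then have "e n * ennreal (norm (\<tau> n)) \<le> e n * (2 * (a n + (\<Sum>q=1..2. ennreal (L1 q) * b q n)))"
      unfolding a_def b_def by (intro mult_left_mono truncation_error_le) auto
    also have "\<dots> = 2 * (e n * a n + (\<Sum>q=1..2. ennreal (L1 q) * (e n * b q n)))"
      by (simp only: distrib_left sum_distrib_left mult.left_commute)
    finally show "e n * ennreal (norm (\<tau> n)) \<le> 2 * (e n * a n + (\<Sum>q=1..2. ennreal (L1 q) * (e n * b q n)))" .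
  qed
  also have "\<dots> = 2 * ((\<Sum>\<^sub>\<infinity>n\<in>{1..}. e n * a n)
      + (\<Sum>q=1..2. ennreal (L1 q) * (\<Sum>\<^sub>\<infinity>n\<in>{1..}. e n * b q n)))"
    by (simp only: infsum_ennreal_cmult infsum_ennreal_add infsum_ennreal_sum)
  also have "(\<Sum>\<^sub>\<infinity>n\<in>{1..}. e n * a n) = e 1 * J1 + ennreal k * (\<Sum>\<^sub>\<infinity>n\<in>{2..}. e n * J n)"
  proof -
    have "{1..} = insert 1 {2::nat..}" by auto
    then have "(\<Sum>\<^sub>\<infinity>n\<in>{1..}. e n * a n) = (\<Sum>\<^sub>\<infinity>n\<in>insert 1 {2..}. e n * a n)" by simp
    also have "\<dots> = e 1 * a 1 + (\<Sum>\<^sub>\<infinity>n\<in>{2..}. e n * a n)"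
      by (intro infsum_insert nonneg_summable_on_complete) auto
    also have "(\<Sum>\<^sub>\<infinity>n\<in>{2..}. e n * a n) = (\<Sum>\<^sub>\<infinity>n\<in>{2..}. ennreal k * (e n * J n))"
      by (intro infsum_cong) (auto simp: a_def mult.left_commute)
    finally show ?thesis by (simp add: infsum_ennreal_cmult a_def)
  qed
  finally show ?thesis by (simp only: b_def)
qed

theorem theorem4p3:
  fixes D :: "nat \<Rightarrow> 'a::{real_inner,banach} set"
    and B :: "nat \<Rightarrow> 'a \<Rightarrow> 'a"
    and \<beta> :: "nat \<Rightarrow> real \<Rightarrow> real"
    and c :: real
  assumes "\<And>q. q \<in> {1..2} \<Longrightarrow> positive_selfadjoint (D q) (B q)"
    and "\<And>q. q \<in> {1..2} \<Longrightarrow> admissible_kernel (\<beta> q)"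
    and "\<And>q. q \<in> {1..2} \<Longrightarrow> \<beta> q absolutely_integrable_on {0<..}"
    and "c > 0"
  shows "\<exists>C::real. C > 0 \<and>
    (\<forall>f u0 u ut utt uttt.
       continuous_on {0..} f \<longrightarrow>
       volterra_solution \<beta> D B f u0 u \<longrightarrow>
       regular_solution D B u ut utt uttt \<longrightarrow>
       (\<forall>k U. k > 0 \<longrightarrow> cn_scheme \<beta> D B f u0 k U \<longrightarrow>
          A_norm c (\<lambda>n. U n - u (real n * k))
          \<le> ennreal (C * k) *
             (ennreal (exp (- (c / 2))) * (\<integral>\<^sup>+\<zeta>\<in>{0..k}. ennreal (norm (utt \<zeta>)) \<partial>lebesgue)
              + ennreal k * (\<Sum>\<^sub>\<infinity>n\<in>{2::nat..}. ennreal (exp (- (c / 2) * real n)) *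
                  (\<integral>\<^sup>+\<zeta>\<in>{(real n - 1) * k..real n * k}. ennreal (norm (uttt \<zeta>)) \<partial>lebesgue))
              + (\<Sum>q=1..2. (\<integral>\<^sup>+t\<in>{0<..}. ennreal \<bar>\<beta> q t\<bar> \<partial>lebesgue) *
                  (\<Sum>\<^sub>\<infinity>n\<in>{1::nat..}. ennreal (exp (- (c / 2) * real n)) *
                     ((\<integral>\<^sup>+\<zeta>\<in>{0..k}. ennreal (norm (B q (ut \<zeta>))) \<partial>lebesgue)
                      + ennreal k *
                        (\<integral>\<^sup>+\<zeta>\<in>{k..real n * k}. ennreal (norm (B q (utt \<zeta>))) \<partial>lebesgue)))))))"
proof -
  \<comment> \<open>A factor 2 from stability, a factor 2 from the truncation error, and the sum of
    the geometric series. It depends on c only.\<close>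
  define C where "C = 4 / (1 - exp (- (c / 2)))"
  have C: "C > 0" using assms(4) by (simp add: C_def)
  define e where "e = (\<lambda>n. ennreal (exp (- (c / 2) * real n)))"
  show ?thesis
  proof (intro exI[of _ C] conjI C allI impI)
    fix f u0 u ut utt uttt k U
    assume f: "continuous_on {0..} f" and vol: "volterra_solution \<beta> D B f u0 u"
      and reg: "regular_solution D B u ut utt uttt" and k: "k > 0"
      and cn: "cn_scheme \<beta> D B f u0 k U"
    define I where "I = (\<lambda>q. \<integral>\<^sup>+\<zeta>\<in>{0..k}. ennreal (norm (B q (ut \<zeta>))) \<partial>lebesgue)"
    define I' where "I' = (\<lambda>q (n::nat). \<integral>\<^sup>+\<zeta>\<in>{k..real n * k}. ennreal (norm (B q (utt \<zeta>))) \<partial>lebesgue)"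
    define R where "R = ennreal (exp (- (c / 2))) * (\<integral>\<^sup>+\<zeta>\<in>{0..k}. ennreal (norm (utt \<zeta>)) \<partial>lebesgue)
      + ennreal k * (\<Sum>\<^sub>\<infinity>n\<in>{2::nat..}. e n *
          (\<integral>\<^sup>+\<zeta>\<in>{(real n - 1) * k..real n * k}. ennreal (norm (uttt \<zeta>)) \<partial>lebesgue))"
    define S where "S = (\<lambda>q. (\<integral>\<^sup>+t\<in>{0<..}. ennreal \<bar>\<beta> q t\<bar> \<partial>lebesgue) *
      (\<Sum>\<^sub>\<infinity>n\<in>{1::nat..}. e n * (I q + ennreal k * I' q n)))"
    have "A_norm c (\<lambda>n. U n - u (real n * k)) \<le> ennreal (C * k) * (R + (\<Sum>q=1..2. S q))"
    proof (cases "\<forall>q\<in>{1..2}. I q < \<infinity>")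
      case True
      interpret scheme_solution D B \<beta> f u ut utt uttt u0 k U
        using assms f vol reg k cn True by unfold_locales (auto simp: I_def)
      have L1: "(\<integral>\<^sup>+t\<in>{0<..}. ennreal \<bar>\<beta> q t\<bar> \<partial>lebesgue) = ennreal (L1 q)" if "q \<in> {1..2}" for q
        unfolding L1_def by (rule nn_integral_abs_half_line[OF assms(3)[OF that]])
      have "A_norm c (\<lambda>n. U n - u (real n * k)) \<le> ennreal (2 * k / (1 - exp (- (c / 2)))) *
          (\<Sum>\<^sub>\<infinity>n\<in>{1..}. e n * ennreal (norm (\<tau> n)))"
        unfolding e_def
        by (rule A_norm_le_of_stability[OF assms(4) k error_stability])
          (use assms(2) in \<open>auto simp: admissible_kernel_def\<close>)
      also have "\<dots> \<le> ennreal (2 * k / (1 - exp (- (c / 2)))) * (2 * (R + (\<Sum>q=1..2. S q)))"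
      proof (rule mult_left_mono)
        have "R + (\<Sum>q=1..2. S q) = e 1 * J1 + ennreal k * (\<Sum>\<^sub>\<infinity>n\<in>{2..}. e n * J n)
          + (\<Sum>q=1..2. ennreal (L1 q) * (\<Sum>\<^sub>\<infinity>n\<in>{1..}. e n * (I0 q + ennreal k * I1 q n)))"
          by (simp add: R_def S_def L1 J1_def J_def I0_def I1_def I_def I'_def e_def)
        then show "(\<Sum>\<^sub>\<infinity>n\<in>{1..}. e n * ennreal (norm (\<tau> n))) \<le> 2 * (R + (\<Sum>q=1..2. S q))"
          using weighted_truncation_error_le[of e] by simp
      qed simp
      also have "\<dots> = ennreal (2 * k / (1 - exp (- (c / 2)))) * ennreal 2 * (R + (\<Sum>q=1..2. S q))"
        by (simp add: mult.assoc)
      also have "ennreal (2 * k / (1 - exp (- (c / 2)))) * ennreal 2 = ennreal (C * k)"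
        using k assms(4) by (subst ennreal_mult[symmetric]) (auto simp: C_def)
      finally show ?thesis .
    next
      case False
      then obtain q where q: "q \<in> {1..2}" and top: "I q = \<infinity>" by (auto simp: less_top[symmetric])
      \<comment> \<open>The first term alone is infinite, as its weight is positive.\<close>
      have "e 1 * (I q + ennreal k * I' q 1) \<le> (\<Sum>\<^sub>\<infinity>n\<in>{1..}. e n * (I q + ennreal k * I' q n))"
        by (rule member_le_infsum_ennreal) simp
      then have "(\<Sum>\<^sub>\<infinity>n\<in>{1..}. e n * (I q + ennreal k * I' q n)) = \<infinity>"
        by (simp add: top e_def ennreal_mult_top top_unique)
      then have "S q = \<infinity>"
        using admissible_kernel_nn_integral_pos[OF assms(2,3)[OF q]]
        by (simp add: S_def ennreal_mult_top)
      moreover have "S q \<le> (\<Sum>q=1..2. S q)"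
        using q by (intro member_le_sum) auto
      ultimately have top_sum: "(\<Sum>q=1..2. S q) = \<infinity>" by (simp only: top_unique infinity_ennreal_def)
      show ?thesis unfolding top_sum using C k by (simp add: ennreal_mult_top)
    qed
    then show "A_norm c (\<lambda>n. U n - u (real n * k))
          \<le> ennreal (C * k) *
             (ennreal (exp (- (c / 2))) * (\<integral>\<^sup>+\<zeta>\<in>{0..k}. ennreal (norm (utt \<zeta>)) \<partial>lebesgue)
              + ennreal k * (\<Sum>\<^sub>\<infinity>n\<in>{2::nat..}. ennreal (exp (- (c / 2) * real n)) *
                  (\<integral>\<^sup>+\<zeta>\<in>{(real n - 1) * k..real n * k}. ennreal (norm (uttt \<zeta>)) \<partial>lebesgue))
              + (\<Sum>q=1..2. (\<integral>\<^sup>+t\<in>{0<..}. ennreal \<bar>\<beta> q t\<bar> \<partial>lebesgue) *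
                  (\<Sum>\<^sub>\<infinity>n\<in>{1::nat..}. ennreal (exp (- (c / 2) * real n)) *
                     ((\<integral>\<^sup>+\<zeta>\<in>{0..k}. ennreal (norm (B q (ut \<zeta>))) \<partial>lebesgue)
                      + ennreal k *
                        (\<integral>\<^sup>+\<zeta>\<in>{k..real n * k}. ennreal (norm (B q (utt \<zeta>))) \<partial>lebesgue)))))"
      unfolding R_def S_def I_def I'_def e_def .
  qed
qed

end
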